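(* For every $Y\in\{\text{TJ},\text{TS},\text{TAR}\}$, the problems PA-Reconf-$Y$ and G-PA-Reconf-$Y$, parameterized by $k$, are fixed-parameter tractable.
   Context: For $A\subseteq V$: $N[A]=A\cup\bigcup_{v\in A}N(v)$, $\partial A=N[A]\setminus A$, $d_A(v)=|N(v)\cap A|$. $A$ is a powerful alliance (PA) if $d_A(v)+1\ge d_{V\setminus A}(v)$ for all $v\in A$ and $d_A(v)\ge d_{V\setminus A}(v)+1$ for all $v\in\partial A$; a global PA (G-PA) is a PA that is a dominating set. Steps: token jumping (TJ): $|A|=|B|$, $|A\setminus B|=1$; token sliding (TS): TJ step with the vertex of $A\setminus B$ adjacent to the vertex of $B\setminus A$; token addition/removal (TAR): one set arises from the other by adding one vertex. $X$-Reconf-$Y$: given $G$, two sets $A_s,A_t$ with property $X$ (and $k$ if $Y=\text{TAR}$), decide whether there is a sequence $A_s=A_1,\dots,A_\ell=A_t$ of sets with property $X$ (each of size at most $k$ if $Y=\text{TAR}$), consecutive sets differing by a $Y$ step. The parameter $k$ is $|A_s|=|A_t|$ for TJ/TS and the size threshold for TAR. *)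

theory Defs
  imports Main "Graph_Theory.Pair_Digraph"
begin

section \<open>Powerful alliances\<close>

text \<open>Finite simple undirected graphs are the instances of the locale \<open>pair_graph\<close>:
  a finite vertex set with a symmetric, irreflexive set of arcs.\<close>

definition neighbours :: "'a pair_pre_digraph \<Rightarrow> 'a \<Rightarrow> 'a set" where
  "neighbours G v = {u. (v, u) \<in> parcs G}"

definition closed_nbhd :: "'a pair_pre_digraph \<Rightarrow> 'a set \<Rightarrow> 'a set" where
  "closed_nbhd G A = A \<union> (\<Union>v\<in>A. neighbours G v)"

definition boundary :: "'a pair_pre_digraph \<Rightarrow> 'a set \<Rightarrow> 'a set" where
  "boundary G A = closed_nbhd G A - A"

definition deg_in :: "'a pair_pre_digraph \<Rightarrow> 'a set \<Rightarrow> 'a \<Rightarrow> nat" where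
  "deg_in G A v = card (neighbours G v \<inter> A)"

definition powerful_alliance :: "'a pair_pre_digraph \<Rightarrow> 'a set \<Rightarrow> bool" where
  "powerful_alliance G A \<longleftrightarrow>
     A \<subseteq> pverts G \<and>
     (\<forall>v\<in>A. deg_in G A v + 1 \<ge> deg_in G (pverts G - A) v) \<and>
     (\<forall>v\<in>boundary G A. deg_in G A v \<ge> deg_in G (pverts G - A) v + 1)"

definition dominating_set :: "'a pair_pre_digraph \<Rightarrow> 'a set \<Rightarrow> bool" where
  "dominating_set G A \<longleftrightarrow> A \<subseteq> pverts G \<and> closed_nbhd G A = pverts G"

definition global_powerful_alliance :: "'a pair_pre_digraph \<Rightarrow> 'a set \<Rightarrow> bool" where
  "global_powerful_alliance G A \<longleftrightarrow> powerful_alliance G A \<and> dominating_set G A"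


section \<open>Reconfiguration\<close>

datatype reconf_rule = TJ | TS | TAR

definition tj_step :: "'a set \<Rightarrow> 'a set \<Rightarrow> bool" where
  "tj_step A B \<longleftrightarrow> card A = card B \<and> card (A - B) = 1"

definition ts_step :: "'a pair_pre_digraph \<Rightarrow> 'a set \<Rightarrow> 'a set \<Rightarrow> bool" where
  "ts_step G A B \<longleftrightarrow> tj_step A B \<and> (\<exists>u v. A - B = {u} \<and> B - A = {v} \<and> (u, v) \<in> parcs G)"

definition tar_step :: "'a set \<Rightarrow> 'a set \<Rightarrow> bool" where
  "tar_step A B \<longleftrightarrow> (\<exists>v. v \<notin> A \<and> B = insert v A) \<or> (\<exists>v. v \<notin> B \<and> A = insert v B)"

fun reconf_step :: "reconf_rule \<Rightarrow> 'a pair_pre_digraph \<Rightarrow> 'a set \<Rightarrow> 'a set \<Rightarrow> bool" where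
  "reconf_step TJ G A B = tj_step A B"
| "reconf_step TS G A B = ts_step G A B"
| "reconf_step TAR G A B = tar_step A B"

definition reconfigurable ::
  "('a pair_pre_digraph \<Rightarrow> 'a set \<Rightarrow> bool) \<Rightarrow> reconf_rule \<Rightarrow> 'a pair_pre_digraph \<Rightarrow> nat
    \<Rightarrow> 'a set \<Rightarrow> 'a set \<Rightarrow> bool" where
  "reconfigurable X Y G k S T \<longleftrightarrow>
     (\<exists>As. As \<noteq> [] \<and> hd As = S \<and> last As = T \<and>
           (\<forall>A\<in>set As. X G A \<and> (Y = TAR \<longrightarrow> card A \<le> k)) \<and>
           successively (reconf_step Y G) As)"


section \<open>Model of computation\<close>

text \<open>
  Programs are written in a first-order, call-by-value functional language over binary trees,
  i.e. pure LISP with the single atom \<open>Leaf\<close> (the language F of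
  N. D. Jones, "Computability and Complexity from a Programming Perspective", MIT Press, 1997).
  A program is a finite list of mutually recursive function bodies, the parameters being
  addressed by position; function \<open>0\<close> is the entry point.  The running time is the number of
  evaluation steps.  Every primitive inspects or builds a single node only, so (keeping trees as
  pointers into a shared heap) each step takes constant time on a pointer machine, and running
  times agree with those of Turing machines up to a polynomial.
\<close>

datatype val = Leaf | Node val val

datatype expr =
    EVar nat
  | ELeaf
  | ENode expr expr
  | EFst expr
  | ESnd expr
  | EIf expr expr expr
  | ECall nat "expr list"

type_synonym prog = "expr list"

fun val_fst :: "val \<Rightarrow> val" where
  "val_fst Leaf = Leaf"
| "val_fst (Node a b) = a"

fun val_snd :: "val \<Rightarrow> val" where
  "val_snd Leaf = Leaf"
| "val_snd (Node a b) = b"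

text \<open>\<open>eval P \<rho> e v t\<close>: in the environment \<open>\<rho>\<close>, expression \<open>e\<close> evaluates to \<open>v\<close> in \<open>t\<close> steps.\<close>

inductive eval :: "prog \<Rightarrow> val list \<Rightarrow> expr \<Rightarrow> val \<Rightarrow> nat \<Rightarrow> bool"
  and evals :: "prog \<Rightarrow> val list \<Rightarrow> expr list \<Rightarrow> val list \<Rightarrow> nat \<Rightarrow> bool"
  for P :: prog where
  Var: "i < length \<rho> \<Longrightarrow> eval P \<rho> (EVar i) (\<rho> ! i) 1"
| Leaf: "eval P \<rho> ELeaf Leaf 1"
| Node: "eval P \<rho> a v s \<Longrightarrow> eval P \<rho> b w t \<Longrightarrow> eval P \<rho> (ENode a b) (Node v w) (s + t + 1)"
| Fst: "eval P \<rho> a v t \<Longrightarrow> eval P \<rho> (EFst a) (val_fst v) (t + 1)"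
| Snd: "eval P \<rho> a v t \<Longrightarrow> eval P \<rho> (ESnd a) (val_snd v) (t + 1)"
| IfTrue: "eval P \<rho> c u s \<Longrightarrow> u \<noteq> Leaf \<Longrightarrow> eval P \<rho> a v t \<Longrightarrow>
    eval P \<rho> (EIf c a b) v (s + t + 1)"
| IfFalse: "eval P \<rho> c Leaf s \<Longrightarrow> eval P \<rho> b v t \<Longrightarrow> eval P \<rho> (EIf c a b) v (s + t + 1)"
| Call: "evals P \<rho> es vs s \<Longrightarrow> f < length P \<Longrightarrow> eval P vs (P ! f) v t \<Longrightarrow>
    eval P \<rho> (ECall f es) v (s + t + 1)"
| Empty: "evals P \<rho> [] [] 0"
| Step: "eval P \<rho> e v s \<Longrightarrow> evals P \<rho> es vs t \<Longrightarrow> evals P \<rho> (e # es) (v # vs) (s + t)"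

lemma eval_deterministic:
  "eval P \<rho> e v t \<Longrightarrow> eval P \<rho> e v' t' \<Longrightarrow> v = v' \<and> t = t'"
  "evals P \<rho> es vs t \<Longrightarrow> evals P \<rho> es vs' t' \<Longrightarrow> vs = vs' \<and> t = t'"
proof (induction arbitrary: v' t' and vs' t' rule: eval_evals.inducts)
  case (Var i \<rho>)
  from Var.prems show ?case by cases auto
next
  case (Leaf \<rho>)
  from Leaf.prems show ?case by cases auto
next
  case (Node \<rho> a v s b w t)
  from Node.prems show ?case by cases (use Node.IH in blast)
next
  case (Fst \<rho> a v t)
  from Fst.prems show ?case by cases (use Fst.IH in blast)
next
  case (Snd \<rho> a v t)
  from Snd.prems show ?case by cases (use Snd.IH in blast)
next
  case (IfTrue \<rho> c u s a v t b)
  from IfTrue.prems show ?case by cases (use IfTrue.IH IfTrue.hyps in blast)+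
next
  case (IfFalse \<rho> c s b v t a)
  from IfFalse.prems show ?case by cases (use IfFalse.IH in blast)+
next
  case (Call \<rho> es vs s f v t)
  from Call.prems show ?case by cases (use Call.IH in blast)
next
  case (Empty \<rho>)
  from Empty.prems show ?case by cases auto
next
  case (Step \<rho> e v s es vs t)
  from Step.prems show ?case by cases (use Step.IH in blast)
qed

definition runs :: "prog \<Rightarrow> val list \<Rightarrow> val \<Rightarrow> nat \<Rightarrow> bool" where
  "runs P args v t \<longleftrightarrow> P \<noteq> [] \<and> eval P args (P ! 0) v t"

definition list_val :: "val list \<Rightarrow> val" where
  "list_val vs = foldr Node vs Leaf"

definition nat_val :: "nat \<Rightarrow> val" where
  "nat_val n = list_val (replicate n Leaf)"

definition bool_val :: "bool \<Rightarrow> val" where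
  "bool_val b = (if b then Node Leaf Leaf else Leaf)"

definition word_val :: "bool list \<Rightarrow> val" where
  "word_val w = list_val (map bool_val w)"

definition computable_nat_fun :: "(nat \<Rightarrow> nat) \<Rightarrow> bool" where
  "computable_nat_fun f \<longleftrightarrow> (\<exists>P. \<forall>n. \<exists>t. runs P [nat_val n] (nat_val (f n)) t)"


section \<open>Fixed-parameter tractability\<close>

text \<open>A parameterized problem is a subset of \<open>\<Sigma>\<^sup>* \<times> \<nat>\<close> with \<open>\<Sigma> = {0, 1}\<close>.
  The summand \<open>1\<close> only matters for the empty word; the parameter is passed in unary, which
  affects the running time only by a factor depending on \<open>k\<close>.\<close>

type_synonym param_problem = "(bool list \<times> nat) set"

definition fixed_parameter_tractable :: "param_problem \<Rightarrow> bool" where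
  "fixed_parameter_tractable L \<longleftrightarrow>
     (\<exists>P f c. computable_nat_fun f \<and>
        (\<forall>w k. \<exists>v t. runs P [word_val w, nat_val k] v t \<and>
                     t \<le> f k * (length w + 1) ^ c \<and>
                     (v \<noteq> Leaf \<longleftrightarrow> (w, k) \<in> L)))"


section \<open>The reconfiguration problems as parameterized problems\<close>

text \<open>A graph with vertex set \<open>{..<n}\<close> and two vertex sets are written as \<open>1\<^sup>n 0\<close>, followed by
  the adjacency matrix row by row and the two characteristic vectors.\<close>

definition instance_word :: "nat pair_pre_digraph \<Rightarrow> nat set \<Rightarrow> nat set \<Rightarrow> bool list" where
  "instance_word G S T =
     (let n = card (pverts G) in
        replicate n True @ [False] @
        concat (map (\<lambda>u. map (\<lambda>v. (u, v) \<in> parcs G) [0..<n]) [0..<n]) @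
        map (\<lambda>v. v \<in> S) [0..<n] @
        map (\<lambda>v. v \<in> T) [0..<n])"

lemma instance_word_inj:
  fixes G H :: "nat pair_pre_digraph"
  assumes G: "pair_graph G" "pverts G = {..<n}" "S \<subseteq> pverts G" "T \<subseteq> pverts G"
    and H: "pair_graph H" "pverts H = {..<m}" "S' \<subseteq> pverts H" "T' \<subseteq> pverts H"
    and eq: "instance_word G S T = instance_word H S' T'"
  shows "G = H \<and> S = S' \<and> T = T'"
proof -
  have takeWhile_word: "length (takeWhile id (replicate i True @ False # xs)) = i" for i xs
    by (induction i) auto
  from arg_cong[OF eq, of "\<lambda>w. length (takeWhile id w)"] have nm: "n = m"
    by (simp add: instance_word_def Let_def G(2) H(2) takeWhile_word)
  let ?row = "\<lambda>G u. map (\<lambda>v. (u, v) \<in> parcs G) [0..<n]"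
  have len: "length (concat (map (?row F) [0..<n])) = n * n" for F :: "nat pair_pre_digraph"
    by (simp add: length_concat o_def sum_list_triv)
  from eq have mat: "concat (map (?row G) [0..<n]) = concat (map (?row H) [0..<n])"
    and S: "map (\<lambda>v. v \<in> S) [0..<n] = map (\<lambda>v. v \<in> S') [0..<n]"
    and T: "map (\<lambda>v. v \<in> T) [0..<n] = map (\<lambda>v. v \<in> T') [0..<n]"
    using len[of G] len[of H] by (simp_all add: instance_word_def Let_def G(2) H(2) nm)
  from mat have "map (?row G) [0..<n] = map (?row H) [0..<n]"
    by (rule concat_injective) (auto simp: in_set_zip)
  hence arcs: "(u, v) \<in> parcs G \<longleftrightarrow> (u, v) \<in> parcs H" if "u < n" "v < n" for u v
    using that by auto
  interpret G: pair_graph G by (rule G(1))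
  interpret H: pair_graph H by (rule H(1))
  have "parcs G = parcs H"
    using arcs G.in_arcsD1 G.in_arcsD2 H.in_arcsD1 H.in_arcsD2 G(2) H(2) nm
    by (metis lessThan_iff subrelI subset_antisym)
  moreover have "S = S'" "T = T'"
    using S T G H nm by auto
  ultimately show ?thesis
    using G(2) H(2) nm by simp
qed

definition reconf_problem ::
  "(nat pair_pre_digraph \<Rightarrow> nat set \<Rightarrow> bool) \<Rightarrow> reconf_rule \<Rightarrow> param_problem" where
  "reconf_problem X Y =
     {(instance_word G S T, k) | G S T k.
        pair_graph G \<and> (\<exists>n. pverts G = {..<n}) \<and> X G S \<and> X G T \<and>
        (Y \<noteq> TAR \<longrightarrow> card S = k \<and> card T = k) \<and>
        reconfigurable X Y G k S T}"

end

theory Submission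
  imports Defs "HOL-Library.Transitive_Closure_Table"
begin

text \<open>
  A reconfiguration step adds at most one vertex \<open>w\<close> to the alliance.  A vertex that thereby enters
  the closed neighbourhood has \<open>w\<close> as its only neighbour in the new alliance, and the defining
  inequalities then force its degree to be at most one.  Hence the set of vertices of degree at
  least two in \<open>N[A]\<close> never changes.  All vertices of \<open>N[A]\<close> have degree at most \<open>2k + 1\<close>, so
  apart from the components with one or two vertices, which carry tokens without any
  constraint, all tokens stay in \<open>N[N[A\<^sub>s]]\<close>, a set of size at most \<open>k (2k + 2)\<^sup>2\<close>.  Under
  sliding, the tokens of these small components stay in \<open>N[A\<^sub>s]\<close>; under jumping and
  addition/removal only their number matters, so \<open>k\<close> vertices of small components suffice to
  represent them.  It remains to search the subsets of a vertex set of size bounded in \<open>k\<close>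
  exhaustively.
\<close>

section \<open>The evaluation relation as a function\<close>

text \<open>Three obstacles shape the development. The time bound has to hold on every word,
  although the search region is bounded in \<open>k\<close> only if the source is an alliance with
  at most \<open>k\<close> vertices. Format, symmetry, alliance conditions and sizes are therefore
  tested before the search starts, and the bound on the search is derived under the outcome of these
  tests.

  For jumping and addition/removal a given walk need not stay in the region, since its
  small-component tokens may be anywhere. It is replaced by its image under a map that puts those
  tokens into a standard position. The two ends are then joined to their images by exchanges inside
  the region, which is why the target set itself is part of the region.

  Such exchanges can destroy domination. For global alliances the region is instead all of the
  graph, because the source already dominates every vertex.

  The search keeps no table of visited sets. The program language has no state, and a plain
  recursion whose depth and branching are both bounded in \<open>k\<close> is good enough for
  fixed-parameter tractability.\<close>

definition ev :: "prog \<Rightarrow> val list \<Rightarrow> expr \<Rightarrow> (val \<times> nat) option" where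
  "ev P \<rho> e = (if \<exists>v t. eval P \<rho> e v t
     then Some (THE r. eval P \<rho> e (fst r) (snd r)) else None)"

definition evs :: "prog \<Rightarrow> val list \<Rightarrow> expr list \<Rightarrow> (val list \<times> nat) option" where
  "evs P \<rho> es = (if \<exists>vs t. evals P \<rho> es vs t
     then Some (THE r. evals P \<rho> es (fst r) (snd r)) else None)"

definition fcall :: "prog \<Rightarrow> nat \<Rightarrow> val list \<Rightarrow> (val \<times> nat) option" where
  "fcall P f vs = (if f < length P then ev P vs (P ! f) else None)"

lemma ev_iff: "ev P \<rho> e = Some (v, t) \<longleftrightarrow> eval P \<rho> e v t"
proof -
  have "(THE r. eval P \<rho> e (fst r) (snd r)) = (v', t')" if "eval P \<rho> e v' t'" for v' t'
    using that by (intro the_equality) (auto dest: eval_deterministic(1)[OF that])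
  then show ?thesis
    unfolding ev_def by (auto dest: eval_deterministic(1))
qed

lemma evs_iff: "evs P \<rho> es = Some (vs, t) \<longleftrightarrow> evals P \<rho> es vs t"
proof -
  have "(THE r. evals P \<rho> es (fst r) (snd r)) = (v', t')" if "evals P \<rho> es v' t'" for v' t'
    using that by (intro the_equality) (auto dest: eval_deterministic(2)[OF that])
  then show ?thesis
    unfolding evs_def by (auto dest: eval_deterministic(2))
qed

lemma option_pair_eqI:
  assumes "\<And>v t. x = Some (v, t) \<longleftrightarrow> y = Some (v, t)"
  shows "x = y"
  using assms by (metis not_None_eq surj_pair)

inductive_cases eval_VarE: "eval P \<rho> (EVar i) v t"
inductive_cases eval_LeafE: "eval P \<rho> ELeaf v t"
inductive_cases eval_NodeE: "eval P \<rho> (ENode a b) v t"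
inductive_cases eval_FstE: "eval P \<rho> (EFst a) v t"
inductive_cases eval_SndE: "eval P \<rho> (ESnd a) v t"
inductive_cases eval_IfE: "eval P \<rho> (EIf c a b) v t"
inductive_cases eval_CallE: "eval P \<rho> (ECall f es) v t"
inductive_cases evals_NilE: "evals P \<rho> [] vs t"
inductive_cases evals_ConsE: "evals P \<rho> (e # es) vs t"

text \<open>The step counts are put into \<open>Suc\<close> form so that the rules unify with the
  right-hand sides of \<open>eval_iffs\<close>.\<close>

lemmas eval_Suc_intros = eval_evals.intros[unfolded One_nat_def add_Suc_right add_0_right]

lemma eval_iffs:
  "eval P \<rho> (EVar i) r n \<longleftrightarrow> i < length \<rho> \<and> r = \<rho> ! i \<and> n = Suc 0"
  "eval P \<rho> ELeaf r n \<longleftrightarrow> r = Leaf \<and> n = Suc 0"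
  "eval P \<rho> (ENode a b) r n \<longleftrightarrow>
     (\<exists>v s w t. eval P \<rho> a v s \<and> eval P \<rho> b w t \<and> r = Node v w \<and> n = Suc (s + t))"
  "eval P \<rho> (EFst a) r n \<longleftrightarrow> (\<exists>v s. eval P \<rho> a v s \<and> r = val_fst v \<and> n = Suc s)"
  "eval P \<rho> (ESnd a) r n \<longleftrightarrow> (\<exists>v s. eval P \<rho> a v s \<and> r = val_snd v \<and> n = Suc s)"
  "eval P \<rho> (EIf c a b) r n \<longleftrightarrow>
     (\<exists>u s t. eval P \<rho> c u s \<and> (if u = Leaf then eval P \<rho> b r t else eval P \<rho> a r t) \<and> n = Suc
         (s + t))"
  "eval P \<rho> (ECall f es) r n \<longleftrightarrow>
     (\<exists>vs s t. evals P \<rho> es vs s \<and> f < length P \<and> eval P vs (P ! f) r t \<and> n = Suc (s + t))"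
  "evals P \<rho> [] rs n \<longleftrightarrow> rs = [] \<and> n = 0"
  "evals P \<rho> (e # es) rs n \<longleftrightarrow>
     (\<exists>v s vs t. eval P \<rho> e v s \<and> evals P \<rho> es vs t \<and> rs = v # vs \<and> n = s + t)"
  subgoal by (blast elim: eval_VarE intro: eval_Suc_intros)
  subgoal by (blast elim: eval_LeafE intro: eval_Suc_intros)
  subgoal by (blast elim: eval_NodeE intro: eval_Suc_intros)
  subgoal by (blast elim: eval_FstE intro: eval_Suc_intros)
  subgoal by (blast elim: eval_SndE intro: eval_Suc_intros)
  subgoal by (rule iffI, erule eval_IfE, auto intro: eval_Suc_intros split: if_splits)
  subgoal by (blast elim: eval_CallE intro: eval_Suc_intros)
  subgoal by (blast elim: evals_NilE intro: eval_Suc_intros)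
  subgoal by (blast elim: evals_ConsE intro: eval_Suc_intros)
  done

text \<open>Because evaluation is deterministic, it is a partial function, and these equations let
  the simplifier execute a body symbolically, producing value and step count together. Execution
  halts at \<open>fcall\<close>, which is not unfolded here; recursive calls thus stay available for
  induction hypotheses.\<close>

lemma ev_simps:
  "ev P \<rho> (EVar i) = (if i < length \<rho> then Some (\<rho> ! i, Suc 0) else None)"
  "ev P \<rho> ELeaf = Some (Leaf, Suc 0)"
  "ev P \<rho> (ENode a b) = Option.bind (ev P \<rho> a) (\<lambda>(v, s).
     Option.bind (ev P \<rho> b) (\<lambda>(w, t). Some (Node v w, Suc (s + t))))"
  "ev P \<rho> (EFst a) = Option.bind (ev P \<rho> a) (\<lambda>(v, s). Some (val_fst v, Suc s))"
  "ev P \<rho> (ESnd a) = Option.bind (ev P \<rho> a) (\<lambda>(v, s). Some (val_snd v, Suc s))"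
  "ev P \<rho> (EIf c a b) = Option.bind (ev P \<rho> c) (\<lambda>(u, s).
     Option.bind (if u = Leaf then ev P \<rho> b else ev P \<rho> a) (\<lambda>(v, t). Some (v, Suc (s + t))))"
  "ev P \<rho> (ECall f es) = Option.bind (evs P \<rho> es) (\<lambda>(vs, s).
     Option.bind (fcall P f vs) (\<lambda>(v, t). Some (v, Suc (s + t))))"
  "evs P \<rho> [] = Some ([], 0)"
  "evs P \<rho> (e # es) = Option.bind (ev P \<rho> e) (\<lambda>(v, s).
     Option.bind (evs P \<rho> es) (\<lambda>(vs, t). Some (v # vs, s + t)))"
  subgoal by (rule option_pair_eqI) (auto simp: ev_iff eval_iffs)
  subgoal by (rule option_pair_eqI) (auto simp: ev_iff eval_iffs)
  subgoal by (rule option_pair_eqI) (auto simp: ev_iff eval_iffs bind_eq_Some_conv; blast)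
  subgoal by (rule option_pair_eqI) (auto simp: ev_iff eval_iffs bind_eq_Some_conv; blast)
  subgoal by (rule option_pair_eqI) (auto simp: ev_iff eval_iffs bind_eq_Some_conv; blast)
  subgoal by (rule option_pair_eqI, subst ev_iff, subst eval_iffs(6))
      (cases "ev P \<rho> c"; auto simp: ev_iff[symmetric] bind_eq_Some_conv split: if_splits)
  subgoal by (rule option_pair_eqI) (auto simp: ev_iff evs_iff fcall_def eval_iffs
      bind_eq_Some_conv; blast)
  subgoal by (rule option_pair_eqI) (auto simp: evs_iff eval_iffs)
  subgoal by (rule option_pair_eqI) (auto simp: ev_iff evs_iff eval_iffs bind_eq_Some_conv; blast)
  done

text \<open>Only an upper bound on the time is kept, so each routine can be given a generous round
  constant instead of its exact step count.\<close>

definition computes :: "prog \<Rightarrow> nat \<Rightarrow> val list \<Rightarrow> val \<Rightarrow> nat \<Rightarrow> bool" where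
  "computes P f vs v b \<longleftrightarrow> (\<exists>t. fcall P f vs = Some (v, t) \<and> t \<le> b)"

lemma computes_mono: "computes P f vs v b \<Longrightarrow> b \<le> b' \<Longrightarrow> computes P f vs v b'"
  by (auto simp: computes_def)

lemma computes_runs: "computes P 0 vs v b \<Longrightarrow> \<exists>t\<le>b. runs P vs v t"
  by (auto simp: computes_def fcall_def runs_def ev_iff split: if_splits)

section \<open>Encodings of numbers, words and lists of words\<close>

lemma list_val_simps [simp]:
  "list_val [] = Leaf" "list_val (v # vs) = Node v (list_val vs)"
  by (simp_all add: list_val_def)

lemma list_val_eq_Leaf [simp]: "list_val vs = Leaf \<longleftrightarrow> vs = []"
  by (cases vs) auto

lemma nat_val_simps [simp]:
  "nat_val 0 = Leaf" "nat_val (Suc n) = Node Leaf (nat_val n)"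
  by (simp_all add: nat_val_def)

lemma bool_val_simps [simp]:
  "bool_val True = Node Leaf Leaf" "bool_val False = Leaf"
  by (simp_all add: bool_val_def)

lemma word_val_simps [simp]:
  "word_val [] = Leaf" "word_val (b # w) = Node (bool_val b) (word_val w)"
  by (simp_all add: word_val_def)

text \<open>The same encoding serves adjacency matrices and lists of candidate sets.\<close>

definition mat_val :: "bool list list \<Rightarrow> val" where
  "mat_val M = list_val (map word_val M)"

lemma mat_val_simps [simp]:
  "mat_val [] = Leaf" "mat_val (r # M) = Node (word_val r) (mat_val M)"
  by (simp_all add: mat_val_def)

lemma bool_val_eq_Leaf [simp]: "bool_val b = Leaf \<longleftrightarrow> \<not> b"
  by (simp add: bool_val_def)

lemma nat_val_eq_Leaf [simp]: "nat_val n = Leaf \<longleftrightarrow> n = 0"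
  by (cases n) auto

lemma word_val_eq_Leaf [simp]: "word_val w = Leaf \<longleftrightarrow> w = []"
  by (cases w) auto

lemma mat_val_eq_Leaf [simp]: "mat_val w = Leaf \<longleftrightarrow> w = []"
  by (cases w) auto

lemma val_snd_word_val [simp]: "val_snd (word_val w) = word_val (tl w)"
  by (cases w) auto

lemma val_snd_mat_val [simp]: "val_snd (mat_val M) = mat_val (tl M)"
  by (cases M) auto

lemma val_snd_nat_val [simp]: "val_snd (nat_val n) = nat_val (n - 1)"
  by (cases n) auto

lemma val_snd_list_val [simp]: "val_snd (list_val vs) = list_val (tl vs)"
  by (cases vs) auto

section \<open>The program\<close>

abbreviation (input) main_fn :: nat where "main_fn \<equiv> 0"
abbreviation (input) split_fn :: nat where "split_fn \<equiv> 1"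
abbreviation (input) le_fn :: nat where "le_fn \<equiv> 2"
abbreviation (input) cnt_fn :: nat where "cnt_fn \<equiv> 3"
abbreviation (input) dif_fn :: nat where "dif_fn \<equiv> 4"
abbreviation (input) cntd_fn :: nat where "cntd_fn \<equiv> 5"
abbreviation (input) pa_fn :: nat where "pa_fn \<equiv> 6"
abbreviation (input) ok_fn :: nat where "ok_fn \<equiv> 7"
abbreviation (input) nb_fn :: nat where "nb_fn \<equiv> 8"
abbreviation (input) high_fn :: nat where "high_fn \<equiv> 9"
abbreviation (input) trunc_fn :: nat where "trunc_fn \<equiv> 10"
abbreviation (input) join_fn :: nat where "join_fn \<equiv> 11"
abbreviation (input) conses_fn :: nat where "conses_fn \<equiv> 12"
abbreviation (input) branch_fn :: nat where "branch_fn \<equiv> 13"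
abbreviation (input) subsets_fn :: nat where "subsets_fn \<equiv> 14"
abbreviation (input) filt_fn :: nat where "filt_fn \<equiv> 15"
abbreviation (input) adj_fn :: nat where "adj_fn \<equiv> 16"
abbreviation (input) one_fn :: nat where "one_fn \<equiv> 17"
abbreviation (input) step_fn :: nat where "step_fn \<equiv> 18"
abbreviation (input) eq_fn :: nat where "eq_fn \<equiv> 19"
abbreviation (input) reach_fn :: nat where "reach_fn \<equiv> 20"
abbreviation (input) some_fn :: nat where "some_fn \<equiv> 21"
abbreviation (input) num_fn :: nat where "num_fn \<equiv> 22"
abbreviation (input) dropw_fn :: nat where "dropw_fn \<equiv> 23"
abbreviation (input) take_fn :: nat where "take_fn \<equiv> 24"
abbreviation (input) drop_fn :: nat where "drop_fn \<equiv> 25"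
abbreviation (input) rows_fn :: nat where "rows_fn \<equiv> 26"
abbreviation (input) drops_fn :: nat where "drops_fn \<equiv> 27"
abbreviation (input) heads_fn :: nat where "heads_fn \<equiv> 28"
abbreviation (input) tails_fn :: nat where "tails_fn \<equiv> 29"
abbreviation (input) sym_fn :: nat where "sym_fn \<equiv> 30"
abbreviation (input) region_fn :: nat where "region_fn \<equiv> 31"
abbreviation (input) search_fn :: nat where "search_fn \<equiv> 32"
abbreviation (input) solve_fn :: nat where "solve_fn \<equiv> 33"
abbreviation (input) sizes_fn :: nat where "sizes_fn \<equiv> 34"
abbreviation (input) check_fn :: nat where "check_fn \<equiv> 35"
abbreviation (input) halve_fn :: nat where "halve_fn \<equiv> 36"

abbreviation ETrue :: expr where "ETrue \<equiv> ENode ELeaf ELeaf"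
abbreviation EAnd :: "expr \<Rightarrow> expr \<Rightarrow> expr" where "EAnd a b \<equiv> EIf a b ELeaf"
abbreviation ENot :: "expr \<Rightarrow> expr" where "ENot a \<equiv> EIf a ELeaf ETrue"

text \<open>Vertex sets are represented by their characteristic vectors.  The fuel of \<open>reach_fn\<close> is the
  list of candidate sets itself, because a shortest walk visits every candidate at most once.\<close>

definition main_body :: expr where
  "main_body =
     EIf (ECall dropw_fn [EVar 0])
       (ECall split_fn [EVar 1, ECall num_fn [EVar 0], ESnd (ECall dropw_fn [EVar 0])])
       ELeaf"

text \<open>The language has no local binding. A value that is needed more than once is bound by
  passing it to a further function, hence the chain from \<open>main_body\<close> through
  \<open>split_body\<close> and \<open>halve_body\<close> to \<open>check_body\<close>, and
  \<open>search_body\<close> after \<open>solve_body\<close>.\<close>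

definition split_body :: expr where
  "split_body =
     ECall halve_fn
       [EVar 0,
        EVar 1,
        ECall rows_fn [EVar 1, EVar 1, EVar 2],
        ECall drops_fn [EVar 1, EVar 1, EVar 2]]"

definition le_body :: expr where
  "le_body =
     EIf (EVar 0) (EAnd (EVar 1) (ECall le_fn [ESnd (EVar 0), ESnd (EVar 1)])) ETrue"

definition cnt_body :: expr where
  "cnt_body =
     EIf (EVar 0)
       (EIf (EAnd (EFst (EVar 0)) (EFst (EVar 1)))
          (ENode ELeaf (ECall cnt_fn [ESnd (EVar 0), ESnd (EVar 1)]))
          (ECall cnt_fn [ESnd (EVar 0), ESnd (EVar 1)]))
       ELeaf"

definition dif_body :: expr where
  "dif_body =
     EIf (EVar 0)
       (ENode (EAnd (EFst (EVar 0)) (ENot (EFst (EVar 1))))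
          (ECall dif_fn [ESnd (EVar 0), ESnd (EVar 1)]))
       ELeaf"

definition cntd_body :: expr where
  "cntd_body =
     ECall cnt_fn [ECall dif_fn [EVar 0, EVar 1], ECall dif_fn [EVar 0, EVar 1]]"

text \<open>The second argument is consumed along with the rows, while the third stays the whole
  vector. A member is tested for the first inequality and a non-member with a neighbour in the set,
  that is, a boundary vertex, for the second. A non-member without such a neighbour is not
  dominated, which is an error only in the global problem, marked by \<open>g\<close>.\<close>

definition pa_body :: "bool \<Rightarrow> expr" where
  "pa_body g =
     EIf (EVar 0)
       (EAnd
          (EIf (EFst (EVar 1))
             (ECall le_fn
                [ECall cntd_fn [EFst (EVar 0), EVar 2],
                 ENode ELeaf (ECall cnt_fn [EFst (EVar 0), EVar 2])])
             (EIf (ECall cnt_fn [EFst (EVar 0), EVar 2])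
                (ECall le_fn
                   [ENode ELeaf (ECall cntd_fn [EFst (EVar 0), EVar 2]),
                    ECall cnt_fn [EFst (EVar 0), EVar 2]])
                (if g then ELeaf else ETrue)))
          (ECall pa_fn [ESnd (EVar 0), ESnd (EVar 1), EVar 2]))
       ETrue"

definition ok_body :: expr where
  "ok_body =
     EAnd
       (ECall le_fn [ECall cnt_fn [EVar 2, EVar 2], EVar 1])
       (ECall pa_fn [EVar 0, EVar 2, EVar 2])"

definition nb_body :: expr where
  "nb_body =
     EIf (EVar 0)
       (ENode
          (EIf (EFst (EVar 1))
             ETrue
             (EIf (ECall cnt_fn [EFst (EVar 0), EVar 2]) ETrue ELeaf))
          (ECall nb_fn [ESnd (EVar 0), ESnd (EVar 1), EVar 2]))
       ELeaf"

definition high_body :: expr where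
  "high_body =
     EIf (EVar 0)
       (ENode
          (EIf (ESnd (ECall cnt_fn [EFst (EVar 0), EFst (EVar 0)])) ETrue ELeaf)
          (ECall high_fn [ESnd (EVar 0)]))
       ELeaf"

definition trunc_body :: expr where
  "trunc_body =
     EIf (EVar 1)
       (EIf (EFst (EVar 1))
          (ENode ELeaf (ECall trunc_fn [EVar 0, ESnd (EVar 1)]))
          (ENode (EIf (EVar 0) ETrue ELeaf)
             (ECall trunc_fn [ESnd (EVar 0), ESnd (EVar 1)])))
       ELeaf"

definition join_body :: expr where
  "join_body =
     EIf (EVar 0)
       (ENode
          (EIf (EFst (EVar 0)) ETrue (EIf (EFst (EVar 1)) ETrue ELeaf))
          (ECall join_fn [ESnd (EVar 0), ESnd (EVar 1)]))
       ELeaf"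

definition conses_body :: expr where
  "conses_body =
     EIf (EVar 1)
       (ENode (ENode (EVar 0) (EFst (EVar 1)))
          (ECall conses_fn [EVar 0, ESnd (EVar 1), EVar 2]))
       (EVar 2)"

definition branch_body :: expr where
  "branch_body =
     EIf (EVar 0)
       (ECall conses_fn [ETrue, EVar 1, ECall conses_fn [ELeaf, EVar 1, ELeaf]])
       (ECall conses_fn [ELeaf, EVar 1, ELeaf])"

definition subsets_body :: expr where
  "subsets_body =
     EIf (EVar 0)
       (ECall branch_fn [EFst (EVar 0), ECall subsets_fn [ESnd (EVar 0)]])
       (ENode ELeaf ELeaf)"

definition filt_body :: expr where
  "filt_body =
     EIf (EVar 2)
       (EIf (ECall ok_fn [EVar 0, EVar 1, EFst (EVar 2)])
          (ENode (EFst (EVar 2)) (ECall filt_fn [EVar 0, EVar 1, ESnd (EVar 2)]))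
          (ECall filt_fn [EVar 0, EVar 1, ESnd (EVar 2)]))
       ELeaf"

definition adj_body :: expr where
  "adj_body =
     EIf (EVar 0)
       (EIf
          (EAnd (EFst (EVar 1)) (ECall cnt_fn [EFst (EVar 0), EVar 2]))
          ETrue
          (ECall adj_fn [ESnd (EVar 0), ESnd (EVar 1), EVar 2]))
       ELeaf"

definition one_body :: expr where
  "one_body =
     EIf (EVar 0) (ENot (ESnd (EVar 0))) ELeaf"

text \<open>Equal cardinality together with one leaving vertex means that one vertex leaves and one
  enters. All three rules are thus decided from the sizes of the two differences, with an adjacency
  test added for sliding.\<close>

definition step_body :: "reconf_rule \<Rightarrow> expr" where
  "step_body Y =
     (case Y of
        TJ \<Rightarrow>
            EAnd
              (ECall one_fn [ECall cntd_fn [EVar 0, EVar 1]])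
              (ECall one_fn [ECall cntd_fn [EVar 1, EVar 0]])
      | TS \<Rightarrow>
            EAnd
              (ECall one_fn [ECall cntd_fn [EVar 0, EVar 1]])
              (EAnd
                 (ECall one_fn [ECall cntd_fn [EVar 1, EVar 0]])
                 (ECall adj_fn
                    [EVar 2,
                     ECall dif_fn [EVar 0, EVar 1],
                     ECall dif_fn [EVar 1, EVar 0]]))
      | TAR \<Rightarrow>
            EIf (ECall cntd_fn [EVar 0, EVar 1])
              (EAnd
                 (ECall one_fn [ECall cntd_fn [EVar 0, EVar 1]])
                 (ENot (ECall cntd_fn [EVar 1, EVar 0])))
              (ECall one_fn [ECall cntd_fn [EVar 1, EVar 0]]))"

definition eq_body :: expr where
  "eq_body =
     EAnd (ENot (ECall cntd_fn [EVar 0, EVar 1])) (ENot (ECall cntd_fn [EVar 1, EVar 0]))"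

definition reach_body :: expr where
  "reach_body =
     EIf (ECall eq_fn [EVar 1, EVar 2])
       ETrue
       (EIf (EVar 0)
          (ECall some_fn [EVar 3, ESnd (EVar 0), EVar 1, EVar 2, EVar 3, EVar 4])
          ELeaf)"

definition some_body :: expr where
  "some_body =
     EIf (EVar 0)
       (EIf
          (EAnd
             (ECall step_fn [EVar 2, EFst (EVar 0), EVar 5])
             (ECall reach_fn [EVar 1, EFst (EVar 0), EVar 3, EVar 4, EVar 5]))
          ETrue
          (ECall some_fn [ESnd (EVar 0), EVar 1, EVar 2, EVar 3, EVar 4, EVar 5]))
       ELeaf"

definition num_body :: expr where
  "num_body =
     EIf (EVar 0)
       (EIf (EFst (EVar 0)) (ENode ELeaf (ECall num_fn [ESnd (EVar 0)])) ELeaf)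
       ELeaf"

definition dropw_body :: expr where
  "dropw_body =
     EIf (EVar 0) (EIf (EFst (EVar 0)) (ECall dropw_fn [ESnd (EVar 0)]) (EVar 0)) ELeaf"

definition take_body :: expr where
  "take_body =
     EIf (EVar 0)
       (EIf (EVar 1)
          (ENode (EFst (EVar 1)) (ECall take_fn [ESnd (EVar 0), ESnd (EVar 1)]))
          ELeaf)
       ELeaf"

definition drop_body :: expr where
  "drop_body =
     EIf (EVar 0) (ECall drop_fn [ESnd (EVar 0), ESnd (EVar 1)]) (EVar 1)"

definition rows_body :: expr where
  "rows_body =
     EIf (EVar 0)
       (ENode (ECall take_fn [EVar 1, EVar 2])
          (ECall rows_fn [ESnd (EVar 0), EVar 1, ECall drop_fn [EVar 1, EVar 2]]))
       ELeaf"

definition drops_body :: expr where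
  "drops_body =
     EIf (EVar 0)
       (ECall drops_fn [ESnd (EVar 0), EVar 1, ECall drop_fn [EVar 1, EVar 2]])
       (EVar 2)"

definition heads_body :: expr where
  "heads_body =
     EIf (EVar 0) (ENode (EFst (EFst (EVar 0))) (ECall heads_fn [ESnd (EVar 0)])) ELeaf"

definition tails_body :: expr where
  "tails_body =
     EIf (EVar 0) (ENode (ESnd (EFst (EVar 0))) (ECall tails_fn [ESnd (EVar 0)])) ELeaf"

text \<open>One round compares the first row with the first column and checks the diagonal entry.
  What remains is the minor without that row and column.\<close>

definition sym_body :: expr where
  "sym_body =
     EIf (EVar 0)
       (EAnd (ENot (EFst (EFst (EVar 0))))
          (EAnd
             (ECall eq_fn [ESnd (EFst (EVar 0)), ECall heads_fn [ESnd (EVar 0)]])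
             (ECall sym_fn [ECall tails_fn [ESnd (EVar 0)]])))
       ETrue"

definition region_body :: expr where
  "region_body =
     ECall join_fn
       [EVar 3,
        ECall join_fn
          [ECall trunc_fn
             [EVar 1,
              ECall nb_fn [EVar 0, ECall high_fn [EVar 0], ECall high_fn [EVar 0]]],
           ECall nb_fn
             [EVar 0,
              ECall nb_fn [EVar 0, EVar 2, EVar 2],
              ECall nb_fn [EVar 0, EVar 2, EVar 2]]]]"

definition search_body :: expr where
  "search_body =
     ECall reach_fn [EVar 3, EVar 1, EVar 2, EVar 3, EVar 0]"

definition solve_body :: expr where
  "solve_body =
     ECall search_fn
       [EVar 1,
        EVar 2,
        EVar 3,
        ECall filt_fn
          [EVar 1,
           EVar 0,
           ECall subsets_fn [ECall region_fn [EVar 1, EVar 0, EVar 2, EVar 3]]]]"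

text \<open>Lower bounds suffice to force equality with \<open>k\<close>, because
  \<open>ok_fn\<close> has already verified the upper bounds.\<close>

definition sizes_body :: "reconf_rule \<Rightarrow> expr" where
  "sizes_body Y =
     (if Y = TAR then ETrue
      else EAnd
             (ECall le_fn [EVar 0, ECall cnt_fn [EVar 1, EVar 1]])
             (ECall le_fn [EVar 0, ECall cnt_fn [EVar 2, EVar 2]]))"

text \<open>The format test consists of the first two comparisons: a word that is too short or too
  long leaves a target vector of the wrong length. The order of the tests matters for the running
  time, since \<open>solve_fn\<close> must be called only when its region is bounded in
  \<open>k\<close>.\<close>

definition check_body :: expr where
  "check_body =
     EAnd (ECall le_fn [EVar 4, EVar 1])
       (EAnd (ECall le_fn [EVar 1, EVar 4])
          (EAnd (ECall sym_fn [EVar 2])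
             (EAnd (ECall ok_fn [EVar 2, EVar 0, EVar 3])
                (EAnd (ECall ok_fn [EVar 2, EVar 0, EVar 4])
                   (EAnd
                      (ECall sizes_fn [EVar 0, EVar 3, EVar 4])
                      (ECall solve_fn [EVar 0, EVar 2, EVar 3, EVar 4]))))))"

definition halve_body :: expr where
  "halve_body =
     ECall check_fn
       [EVar 0,
        EVar 1,
        EVar 2,
        ECall take_fn [EVar 1, EVar 3],
        ECall drop_fn [EVar 1, EVar 3]]"

definition alg :: "bool \<Rightarrow> reconf_rule \<Rightarrow> prog" where
  "alg g Y =
    [main_body, split_body, le_body, cnt_body, dif_body, cntd_body, pa_body g, ok_body,
     nb_body, high_body, trunc_body, join_body, conses_body, branch_body, subsets_body,
     filt_body, adj_body, one_body, step_body Y, eq_body, reach_body, some_body, num_body,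
     dropw_body, take_body, drop_body, rows_body, drops_body, heads_body, tails_body,
     sym_body, region_body, search_body, solve_body, sizes_body Y, check_body,
     halve_body]"

text \<open>The simplifier turns the index \<open>1\<close> into \<open>Suc 0\<close>, so \<open>split_fn\<close> has to be listed in that
  form.\<close>

lemma alg_nth [simp]:
  "alg g Y ! main_fn = main_body"
  "alg g Y ! Suc 0 = split_body"
  "alg g Y ! le_fn = le_body"
  "alg g Y ! cnt_fn = cnt_body"
  "alg g Y ! dif_fn = dif_body"
  "alg g Y ! cntd_fn = cntd_body"
  "alg g Y ! pa_fn = pa_body g"
  "alg g Y ! ok_fn = ok_body"
  "alg g Y ! nb_fn = nb_body"
  "alg g Y ! high_fn = high_body"
  "alg g Y ! trunc_fn = trunc_body"
  "alg g Y ! join_fn = join_body"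
  "alg g Y ! conses_fn = conses_body"
  "alg g Y ! branch_fn = branch_body"
  "alg g Y ! subsets_fn = subsets_body"
  "alg g Y ! filt_fn = filt_body"
  "alg g Y ! adj_fn = adj_body"
  "alg g Y ! one_fn = one_body"
  "alg g Y ! step_fn = step_body Y"
  "alg g Y ! eq_fn = eq_body"
  "alg g Y ! reach_fn = reach_body"
  "alg g Y ! some_fn = some_body"
  "alg g Y ! num_fn = num_body"
  "alg g Y ! dropw_fn = dropw_body"
  "alg g Y ! take_fn = take_body"
  "alg g Y ! drop_fn = drop_body"
  "alg g Y ! rows_fn = rows_body"
  "alg g Y ! drops_fn = drops_body"
  "alg g Y ! heads_fn = heads_body"
  "alg g Y ! tails_fn = tails_body"
  "alg g Y ! sym_fn = sym_body"
  "alg g Y ! region_fn = region_body"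
  "alg g Y ! search_fn = search_body"
  "alg g Y ! solve_fn = solve_body"
  "alg g Y ! sizes_fn = sizes_body Y"
  "alg g Y ! check_fn = check_body"
  "alg g Y ! halve_fn = halve_body"
  by (simp_all add: alg_def)

lemma length_alg [simp]: "length (alg g Y) = 37"
  by (simp add: alg_def)

section \<open>Values and running times\<close>

text \<open>Used with \<open>subst\<close>, so that exactly the outermost call is unfolded and the
  inner ones remain \<open>fcall\<close> terms.\<close>

lemma computes_alg_iff:
  "computes (alg g Y) f vs v b \<longleftrightarrow>
     f < 37 \<and> (\<exists>t. ev (alg g Y) vs (alg g Y ! f) = Some (v, t) \<and> t \<le> b)"
  by (auto simp: computes_def fcall_def)

text \<open>Stated for arbitrary lists because the routine looks only at the spine. It can then
  compare unary numbers with each other and with the length of a word.\<close>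

lemma computes_le:
  "computes (alg g Y) le_fn [list_val xs, list_val ys] (bool_val (length xs \<le> length ys)) (40 *
      (length xs + 1))"
proof (induction xs arbitrary: ys)
  case Nil
  show ?case by (subst computes_alg_iff) (auto simp: ev_simps le_body_def)
next
  case (Cons x xs)
  show ?case
  proof (cases ys)
    case Nil
    then show ?thesis by (subst computes_alg_iff) (auto simp: ev_simps le_body_def)
  next
    case (Cons y ys')
    show ?thesis
      using Cons.IH[of ys', unfolded computes_def] \<open>ys = y # ys'\<close>
      by (subst computes_alg_iff) (auto simp: ev_simps le_body_def)
  qed
qed

fun cnt :: "bool list \<Rightarrow> bool list \<Rightarrow> nat" where
  "cnt (x # xs) (y # ys) = (if x \<and> y then Suc (cnt xs ys) else cnt xs ys)"
| "cnt _ _ = 0"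

lemma computes_cnt:
  assumes "length xs = length ys"
  shows "computes (alg g Y) cnt_fn [word_val xs, word_val ys] (nat_val (cnt xs ys)) (40 *
      (length xs + 1))"
  using assms
proof (induction xs ys rule: list_induct2)
  case Nil
  show ?case by (subst computes_alg_iff) (auto simp: ev_simps cnt_body_def)
next
  case (Cons x xs y ys)
  show ?case
    using Cons.IH[unfolded computes_def]
    by (subst computes_alg_iff) (auto simp: ev_simps cnt_body_def)
qed

lemma cnt_le: "cnt xs ys \<le> length xs"
  by (induction xs ys rule: cnt.induct) auto

definition dif :: "bool list \<Rightarrow> bool list \<Rightarrow> bool list" where
  "dif xs ys = map2 (\<lambda>x y. x \<and> \<not> y) xs ys"

lemma computes_dif:
  assumes "length xs = length ys"
  shows "computes (alg g Y) dif_fn [word_val xs, word_val ys] (word_val (dif xs ys)) (40 *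
      (length xs + 1))"
  using assms
proof (induction xs ys rule: list_induct2)
  case Nil
  show ?case by (subst computes_alg_iff) (auto simp: ev_simps dif_body_def dif_def)
next
  case (Cons x xs y ys)
  show ?case
    using Cons.IH[unfolded computes_def]
    by (subst computes_alg_iff) (auto simp: ev_simps dif_body_def dif_def)
qed

lemma length_dif [simp]: "length (dif xs ys) = min (length xs) (length ys)"
  by (simp add: dif_def)

definition cntd :: "bool list \<Rightarrow> bool list \<Rightarrow> nat" where
  "cntd xs ys = cnt (dif xs ys) (dif xs ys)"

lemma cntd_le: "cntd xs ys \<le> length xs"
  unfolding cntd_def by (rule order_trans[OF cnt_le]) simp

lemma computes_cntd:
  assumes "length xs = length ys"
  shows "computes (alg g Y) cntd_fn [word_val xs, word_val ys] (nat_val (cntd xs ys)) (160 *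
      (length xs + 1))"
  using computes_dif[OF assms, of g Y, unfolded computes_def]
    computes_cnt[of "dif xs ys" "dif xs ys" g Y, unfolded computes_def] assms
  by (subst computes_alg_iff) (auto simp: ev_simps cntd_body_def cntd_def)

lemma computes_le_nat:
  "computes (alg g Y) le_fn [nat_val m, nat_val n] (bool_val (m \<le> n)) (40 * (m + 1))"
  using computes_le[of g Y "replicate m Leaf" "replicate n Leaf"]
  by (simp add: nat_val_def)

section \<open>The test of the alliance conditions\<close>

fun pa_rows :: "bool \<Rightarrow> bool list list \<Rightarrow> bool list \<Rightarrow> bool list \<Rightarrow> bool" where
  "pa_rows g (r # M) (b # B) A \<longleftrightarrow>
     (if b then cntd r A \<le> Suc (cnt r A)
      else if cnt r A = 0 then \<not> g else Suc (cntd r A) \<le> cnt r A) \<and> pa_rows g M B A"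
| "pa_rows g _ _ A \<longleftrightarrow> True"

lemma computes_pa:
  assumes "length M = length B" "\<forall>r\<in>set M. length r = length A"
  shows "computes (alg g Y) pa_fn [mat_val M, word_val B, word_val A]
    (bool_val (pa_rows g M B A)) (500 * (length M + 1) * (length A + 1))"
  using assms
proof (induction M B rule: list_induct2)
  case Nil
  show ?case by (subst computes_alg_iff) (auto simp: ev_simps pa_body_def)
next
  case (Cons r M b B)
  then have r: "length r = length A" and "\<forall>r\<in>set M. length r = length A"
    by auto
  note IH = Cons.IH[OF this(2), unfolded computes_def]
  \<comment> \<open>Comparing unary numbers costs time proportional to their value; these bounds
    express that cost through the length of \<open>A\<close>.\<close>
  have bd: "cnt r A \<le> length A" "cntd r A \<le> length A"
    using cnt_le[of r A] cntd_le[of r A] r by auto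
  show ?case
    using IH computes_cnt[OF r, of g Y, unfolded computes_def]
      computes_cntd[OF r, of g Y, unfolded computes_def]
      computes_le_nat[of g Y "cntd r A" "Suc (cnt r A)", unfolded computes_def]
      computes_le_nat[of g Y "Suc (cntd r A)" "cnt r A", unfolded computes_def] bd r
    by (subst computes_alg_iff) (auto simp: ev_simps pa_body_def algebra_simps)
qed

definition ok :: "bool \<Rightarrow> bool list list \<Rightarrow> nat \<Rightarrow> bool list \<Rightarrow> bool" where
  "ok g M k A \<longleftrightarrow> cnt A A \<le> k \<and> pa_rows g M A A"

definition square :: "nat \<Rightarrow> bool list list \<Rightarrow> bool" where
  "square n M \<longleftrightarrow> length M = n \<and> (\<forall>r\<in>set M. length r = n)"

lemma computes_ok:
  assumes "square n M" "length A = n"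
  shows "computes (alg g Y) ok_fn [mat_val M, nat_val k, word_val A]
    (bool_val (ok g M k A)) (600 * (n + 1) * (n + 1))"
  using computes_le_nat[of g Y "cnt A A" k, unfolded computes_def]
    computes_cnt[of A A g Y, unfolded computes_def]
    computes_pa[of M A A g Y, unfolded computes_def] assms cnt_le[of A A]
  by (subst computes_alg_iff) (auto simp: ev_simps ok_body_def square_def ok_def algebra_simps)

section \<open>Neighbourhoods and selection of vertices of small components\<close>

definition nbh :: "bool list list \<Rightarrow> bool list \<Rightarrow> bool list \<Rightarrow> bool list" where
  "nbh M B A = map2 (\<lambda>r b. b \<or> cnt r A \<noteq> 0) M B"

lemma computes_nb:
  assumes "length M = length B" "\<forall>r\<in>set M. length r = length A"
  shows "computes (alg g Y) nb_fn [mat_val M, word_val B, word_val A]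
    (word_val (nbh M B A)) (100 * (length M + 1) * (length A + 1))"
  using assms
proof (induction M B rule: list_induct2)
  case Nil
  show ?case by (subst computes_alg_iff) (auto simp: ev_simps nb_body_def nbh_def)
next
  case (Cons r M b B)
  then have r: "length r = length A" and "\<forall>r\<in>set M. length r = length A"
    by auto
  note IH = Cons.IH[OF this(2), unfolded computes_def]
  show ?case
    using IH computes_cnt[OF r, of g Y, unfolded computes_def] r
    by (subst computes_alg_iff) (auto simp: ev_simps nb_body_def nbh_def algebra_simps)
qed

definition high :: "bool list list \<Rightarrow> bool list" where
  "high M = map (\<lambda>r. 2 \<le> cnt r r) M"

lemma computes_high:
  assumes "\<forall>r\<in>set M. length r = n"
  shows "computes (alg g Y) high_fn [mat_val M] (word_val (high M)) (100 * (length M + 1) *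
      (n + 1))"
  using assms
proof (induction M)
  case Nil
  show ?case by (subst computes_alg_iff) (auto simp: ev_simps high_body_def high_def)
next
  case (Cons r M)
  then have r: "length r = n" and "\<forall>r\<in>set M. length r = n"
    by auto
  note IH = Cons.IH[OF this(2), unfolded computes_def]
  show ?case
    using IH computes_cnt[of r r g Y, unfolded computes_def] r
    by (subst computes_alg_iff) (auto simp: ev_simps high_body_def high_def algebra_simps)
qed

fun trunc :: "nat \<Rightarrow> bool list \<Rightarrow> bool list" where
  "trunc k [] = []"
| "trunc k (x # xs) = (if x then False # trunc k xs else (k \<noteq> 0) # trunc (k - 1) xs)"

lemma length_trunc [simp]: "length (trunc k xs) = length xs"
  by (induction k xs rule: trunc.induct) auto

lemma computes_trunc:
  "computes (alg g Y) trunc_fn [nat_val k, word_val xs] (word_val (trunc k xs)) (40 *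
      (length xs + 1))"
proof (induction xs arbitrary: k)
  case Nil
  show ?case by (subst computes_alg_iff) (auto simp: ev_simps trunc_body_def)
next
  case (Cons x xs)
  show ?case
    using Cons.IH[of k, unfolded computes_def] Cons.IH[of "k - 1", unfolded computes_def]
    by (subst computes_alg_iff) (auto simp: ev_simps trunc_body_def)
qed

definition join :: "bool list \<Rightarrow> bool list \<Rightarrow> bool list" where
  "join xs ys = map2 (\<or>) xs ys"

lemma length_join [simp]: "length (join xs ys) = min (length xs) (length ys)"
  by (simp add: join_def)

lemma computes_join:
  assumes "length xs = length ys"
  shows "computes (alg g Y) join_fn [word_val xs, word_val ys] (word_val (join xs ys)) (40 *
      (length xs + 1))"
  using assms
proof (induction xs ys rule: list_induct2)
  case Nil
  show ?case by (subst computes_alg_iff) (auto simp: ev_simps join_body_def join_def)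
next
  case (Cons x xs y ys)
  show ?case
    using Cons.IH[unfolded computes_def]
    by (subst computes_alg_iff) (auto simp: ev_simps join_body_def join_def)
qed

section \<open>Enumeration of the candidate sets\<close>

lemma computes_conses:
  "computes (alg g Y) conses_fn [bool_val b, mat_val L, mat_val R]
    (mat_val (map ((#) b) L @ R)) (40 * (length L + 1))"
proof (induction L)
  case Nil
  show ?case by (subst computes_alg_iff) (auto simp: ev_simps conses_body_def)
next
  case (Cons x L)
  show ?case
    using Cons.IH[unfolded computes_def]
    by (subst computes_alg_iff) (auto simp: ev_simps conses_body_def)
qed

definition branch :: "bool \<Rightarrow> bool list list \<Rightarrow> bool list list" where
  "branch u L = (if u then map ((#) True) L @ map ((#) False) L else map ((#) False) L)"

lemma computes_branch:
  "computes (alg g Y) branch_fn [bool_val u, mat_val L] (mat_val (branch u L)) (120 *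
      (length L + 1))"
  using computes_conses[of g Y False L "[]", unfolded computes_def]
    computes_conses[of g Y True L "map ((#) False) L", unfolded computes_def]
  by (subst computes_alg_iff) (auto simp: ev_simps branch_body_def branch_def)

primrec subvectors :: "bool list \<Rightarrow> bool list list" where
  "subvectors [] = [[]]"
| "subvectors (u # us) = branch u (subvectors us)"

lemma subvectors_pos: "1 \<le> length (subvectors us)"
  by (induction us) (auto simp: branch_def)

lemma length_subvectors: "length (subvectors us) = 2 ^ cnt us us"
  by (induction us) (auto simp: branch_def)

lemma computes_subsets:
  "computes (alg g Y) subsets_fn [word_val us] (mat_val (subvectors us))
    (300 * (length us + 1) * length (subvectors us))"
proof (induction us)
  case Nil
  show ?case by (subst computes_alg_iff) (auto simp: ev_simps subsets_body_def)
next
  case (Cons u us)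
  let ?m = "length (subvectors us)"
  have m: "1 \<le> ?m" "?m \<le> length (branch u (subvectors us))"
    using subvectors_pos[of us] by (auto simp: branch_def)
  \<comment> \<open>The call of \<open>branch_fn\<close> and the overhead cost
    \<open>120 * (?m + 1) + 40\<close>, which is at most \<open>300 * ?m\<close> because
    \<open>?m\<close> is positive.\<close>
  have "300 * (length us + 1) * ?m + 120 * (?m + 1) + 40 \<le> 300 * (length us + 2) * ?m"
    using m(1) by (simp add: algebra_simps)
  also have "\<dots> \<le> 300 * (length us + 2) * length (branch u (subvectors us))"
    using m(2) by simp
  finally show ?case
    using Cons.IH[unfolded computes_def] computes_branch[of g Y u
        "subvectors us", unfolded computes_def]
    by (subst computes_alg_iff) (auto simp: ev_simps subsets_body_def)
qed

lemma computes_filt: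
  assumes "square n M" "\<forall>A\<in>set L. length A = n"
  shows "computes (alg g Y) filt_fn [mat_val M, nat_val k, mat_val L]
    (mat_val (filter (ok g M k) L)) (700 * (length L + 1) * (n + 1) * (n + 1))"
  using assms(2)
proof (induction L)
  case Nil
  show ?case by (subst computes_alg_iff) (auto simp: ev_simps filt_body_def)
next
  case (Cons A L)
  then have A: "length A = n" and "\<forall>A\<in>set L. length A = n"
    by auto
  note IH = Cons.IH[OF this(2), unfolded computes_def]
  show ?case
    using IH computes_ok[OF assms(1) A, of g Y k, unfolded computes_def]
    by (subst computes_alg_iff) (auto simp: ev_simps filt_body_def algebra_simps)
qed

section \<open>Reconfiguration steps and the search of bounded depth\<close>

fun adj :: "bool list list \<Rightarrow> bool list \<Rightarrow> bool list \<Rightarrow> bool" where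
  "adj (r # M) (x # xs) ys \<longleftrightarrow> x \<and> cnt r ys \<noteq> 0 \<or> adj M xs ys"
| "adj _ _ _ \<longleftrightarrow> False"

lemma computes_adj:
  assumes "length M = length xs" "\<forall>r\<in>set M. length r = length ys"
  shows "computes (alg g Y) adj_fn [mat_val M, word_val xs, word_val ys]
    (bool_val (adj M xs ys)) (100 * (length M + 1) * (length ys + 1))"
  using assms
proof (induction M xs rule: list_induct2)
  case Nil
  show ?case by (subst computes_alg_iff) (auto simp: ev_simps adj_body_def)
next
  case (Cons r M x xs)
  then have r: "length r = length ys" and "\<forall>r\<in>set M. length r = length ys"
    by auto
  note IH = Cons.IH[OF this(2), unfolded computes_def]
  show ?case
    using IH computes_cnt[OF r, of g Y, unfolded computes_def] r
    by (subst computes_alg_iff) (auto simp: ev_simps adj_body_def algebra_simps)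
qed

lemma computes_one:
  "computes (alg g Y) one_fn [nat_val n] (bool_val (n = 1)) 40"
  by (subst computes_alg_iff) (auto simp: ev_simps one_body_def)

definition step :: "reconf_rule \<Rightarrow> bool list list \<Rightarrow> bool list \<Rightarrow> bool list \<Rightarrow> bool" where
  "step Y M A B \<longleftrightarrow> (case Y of
     TJ \<Rightarrow> cntd A B = 1 \<and> cntd B A = 1
   | TS \<Rightarrow> cntd A B = 1 \<and> cntd B A = 1 \<and> adj M (dif A B) (dif B A)
   | TAR \<Rightarrow> cntd A B = 1 \<and> cntd B A = 0 \<or> cntd A B = 0 \<and> cntd B A = 1)"

lemma computes_step:
  assumes "square n M" "length A = n" "length B = n"
  shows "computes (alg g Y) step_fn [word_val A, word_val B, mat_val M]
    (bool_val (step Y M A B)) (1000 * (n + 1) * (n + 1))"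
proof -
  have AB: "length A = length B"
    using assms by simp
  note c = computes_cntd[OF AB, of g Y, unfolded computes_def]
    computes_cntd[OF AB[symmetric], of g Y, unfolded computes_def]
    computes_one[of g Y "cntd A B", unfolded computes_def]
    computes_one[of g Y "cntd B A", unfolded computes_def]
    computes_dif[OF AB, of g Y, unfolded computes_def]
    computes_dif[OF AB[symmetric], of g Y, unfolded computes_def]
  show ?thesis
  proof (cases Y)
    case TS
    have "length M = length (dif A B)" "\<forall>r\<in>set M. length r = length (dif B A)"
      using assms by (auto simp: square_def)
    from computes_adj[OF this, of g Y, unfolded computes_def]
    show ?thesis using c assms TS
      by (subst computes_alg_iff) (auto simp: ev_simps step_body_def step_def square_def
          algebra_simps)
  next
    case TJ
    then show ?thesis using c assms
      by (subst computes_alg_iff) (auto simp: ev_simps step_body_def step_def algebra_simps)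
  next
    case TAR
    then show ?thesis using c assms
      by (subst computes_alg_iff) (auto simp: ev_simps step_body_def step_def algebra_simps)
  qed
qed

lemma cnt_self_eq_0: "cnt xs xs = 0 \<longleftrightarrow> True \<notin> set xs"
  by (induction xs) auto

lemma cntd_0_iff: "length A = length B \<Longrightarrow> cntd A B = 0 \<and> cntd B A = 0 \<longleftrightarrow> A = B"
  unfolding cntd_def cnt_self_eq_0 dif_def by (induction A B rule: list_induct2) auto

lemma computes_eq:
  assumes "length A = length B"
  shows "computes (alg g Y) eq_fn [word_val A, word_val B] (bool_val (A = B)) (400 *
      (length A + 1))"
  unfolding cntd_0_iff[OF assms, symmetric]
  using computes_cntd[OF assms, of g Y, unfolded computes_def]
    computes_cntd[OF assms[symmetric], of g Y, unfolded computes_def] assms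
  by (subst computes_alg_iff, cases "cntd A B = 0"; cases "cntd B A = 0")
    (auto simp: ev_simps eq_body_def)

primrec reach :: "reconf_rule \<Rightarrow> bool list list \<Rightarrow> bool list \<Rightarrow> bool list list \<Rightarrow> nat \<Rightarrow> bool list \<Rightarrow>
    bool"
  where
  "reach Y M T C 0 A \<longleftrightarrow> A = T"
| "reach Y M T C (Suc j) A \<longleftrightarrow> A = T \<or> (\<exists>B\<in>set C. step Y M A B \<and> reach Y M T C j B)"

text \<open>\<open>J\<close> is fuel, and only its length counts. Each level contributes a factor
  \<open>2 * (length C + 2)\<close>: one scan of \<open>C\<close> with its empty end, one equality
  test, and a factor two for estimating local tests by the cost of a recursive call.\<close>

lemma computes_reach:
  assumes M: "square n M" and T: "length T = n" and C: "\<forall>B\<in>set C. length B = n" and A: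
      "length A = n"
  shows "computes (alg g Y) reach_fn [mat_val J, word_val A, word_val T, mat_val C, mat_val M]
    (bool_val (reach Y M T C (length J) A))
    (2000 * (n + 1) * (n + 1) * (2 * (length C + 2)) ^ (length J + 1))"
  using A
proof (induction J arbitrary: A)
  case Nil
  have "computes (alg g Y) eq_fn [word_val A, word_val T] (bool_val (A = T)) (400 * (n + 1))"
    using computes_eq[of A T g Y] Nil T by simp
  then have "computes (alg g Y) reach_fn [mat_val [], word_val A, word_val T, mat_val C, mat_val M]
      (bool_val (reach Y M T C (length ([] :: bool list list)) A)) (500 * (n + 1))"
    unfolding computes_def[of _ eq_fn] by (subst computes_alg_iff)
        (auto simp: ev_simps reach_body_def)
  moreover have "500 * (n + 1) * 1 * 1
      \<le> 2000 * (n + 1) * (n + 1) * (2 * (length C + 2)) ^ (length ([] :: bool list list) + 1)"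
    by (intro mult_le_mono) auto
  ultimately show ?case
    unfolding mult_1_right by (rule computes_mono)
next
  case (Cons x J)
  \<comment> \<open>\<open>Q\<close> pays for one local test with its overhead, \<open>R\<close> for
    a recursive call with one unit of fuel less.\<close>
  define Q where "Q = 2000 * (n + 1) * (n + 1)"
  define R where "R = Q * (2 * (length C + 2)) ^ (length J + 1)"
  have bnd: "1000 * (n + 1) * (n + 1) + 40 \<le> Q" "400 * (n + 1) + 40 \<le> Q"
    by (simp_all add: Q_def algebra_simps)
  have "Q * 1 \<le> R"
    unfolding R_def by (intro mult_le_mono one_le_power) auto
  then have QR: "Q \<le> R"
    by simp
  have IH: "computes (alg g Y) reach_fn [mat_val J, word_val B, word_val T, mat_val C, mat_val M]
      (bool_val (reach Y M T C (length J) B)) R" if "length B = n" for B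
    using Cons.IH[OF that] by (simp add: R_def Q_def)
  \<comment> \<open>\<open>some_fn\<close> and \<open>reach_fn\<close> call each other. The outer
    induction on the fuel covers \<open>reach_fn\<close> at the smaller fuel, so that an inner
    induction on the scanned list \<open>L\<close> suffices here.\<close>
  have some: "computes (alg g Y) some_fn
      [mat_val L, mat_val J, word_val A, word_val T, mat_val C, mat_val M]
      (bool_val (\<exists>B\<in>set L. step Y M A B \<and> reach Y M T C (length J) B)) ((length L + 1) * (Q + R))"
    if "\<forall>B\<in>set L. length B = n" for L
    using that
  proof (induction L)
    case Nil
    have "20 \<le> Q + R"
      using bnd by simp
    then show ?case
      by (subst computes_alg_iff) (auto simp: ev_simps some_body_def)
  next
    case (Cons B L)
    then have B: "length B = n" and "\<forall>B\<in>set L. length B = n"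
      by auto
    note IH' = Cons.IH[OF this(2), unfolded computes_def]
    \<comment> \<open>The 40 steps held back from \<open>Q\<close> pay for the nodes of
      \<open>some_body\<close> around the two calls.\<close>
    have st: "computes (alg g Y) step_fn [word_val A, word_val B, mat_val M]
      (bool_val (step Y M A B)) (Q - 40)"
      by (rule computes_mono[OF computes_step[OF M \<open>length A = n\<close> B]]) (use bnd(1) in simp)
    have "40 \<le> Q"
      using bnd by simp
    then show ?case
      using IH' IH[OF B, unfolded computes_def] st[unfolded computes_def]
      by (subst computes_alg_iff) (auto simp: ev_simps some_body_def algebra_simps)
  qed
  have eq: "computes (alg g Y) eq_fn [word_val A, word_val T] (bool_val (A = T)) (Q - 40)"
    by (rule computes_mono[OF computes_eq]) (use Cons.prems T bnd(2) in simp_all)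
  have "Q + (length C + 1) * (Q + R) \<le> (length C + 2) * (2 * R)"
  proof -
    have "Q + (length C + 1) * (Q + R) \<le> R + (length C + 1) * (R + R)"
      using QR by (intro add_mono mult_le_mono) auto
    also have "\<dots> \<le> (length C + 2) * (2 * R)"
      by (simp add: algebra_simps)
    finally show ?thesis .
  qed
  also have "\<dots> = 2000 * (n + 1) * (n + 1) * (2 * (length C + 2)) ^ (length (x # J) + 1)"
    by (simp only: R_def Q_def length_Cons add_Suc power_Suc mult_ac)
  finally have fin: "Q + (length C + 1) * (Q + R)
    \<le> 2000 * (n + 1) * (n + 1) * (2 * (length C + 2)) ^ (length (x # J) + 1)" .
  have "40 \<le> Q"
    using bnd by simp
  then have "computes (alg g Y) reach_fn [mat_val (x # J), word_val A, word_val T, mat_val C,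
      mat_val M]
    (bool_val (reach Y M T C (length (x # J)) A)) (Q + (length C + 1) * (Q + R))"
    using some[OF C, unfolded computes_def] eq[unfolded computes_def]
    by (subst computes_alg_iff) (auto simp: ev_simps reach_body_def)
  then show ?case
    using fin by (rule computes_mono)
qed

section \<open>Splitting the input word\<close>

lemma computes_num:
  "computes (alg g Y) num_fn [word_val w] (nat_val (length (takeWhile id w))) (40 * (length w + 1))"
proof (induction w)
  case Nil
  show ?case by (subst computes_alg_iff) (auto simp: ev_simps num_body_def)
next
  case (Cons x w)
  show ?case
    using Cons.IH[unfolded computes_def]
    by (subst computes_alg_iff) (auto simp: ev_simps num_body_def)
qed

lemma computes_dropw:
  "computes (alg g Y) dropw_fn [word_val w] (word_val (dropWhile id w)) (40 * (length w + 1))"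
proof (induction w)
  case Nil
  show ?case by (subst computes_alg_iff) (auto simp: ev_simps dropw_body_def)
next
  case (Cons x w)
  show ?case
    using Cons.IH[unfolded computes_def]
    by (subst computes_alg_iff) (auto simp: ev_simps dropw_body_def)
qed

lemma computes_take:
  "computes (alg g Y) take_fn [nat_val n, word_val w] (word_val (take n w)) (40 * (n + 1))"
proof (induction n arbitrary: w)
  case 0
  show ?case by (subst computes_alg_iff) (auto simp: ev_simps take_body_def)
next
  case (Suc n)
  show ?case
  proof (cases w)
    case Nil
    then show ?thesis by (subst computes_alg_iff) (auto simp: ev_simps take_body_def)
  next
    case (Cons b w')
    then show ?thesis
      using Suc.IH[of w', unfolded computes_def]
      by (subst computes_alg_iff) (auto simp: ev_simps take_body_def)
  qed
qed

lemma computes_drop: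
  "computes (alg g Y) drop_fn [nat_val n, word_val w] (word_val (drop n w)) (40 * (n + 1))"
proof (induction n arbitrary: w)
  case 0
  show ?case by (subst computes_alg_iff) (auto simp: ev_simps drop_body_def)
next
  case (Suc n)
  show ?case
    using Suc.IH[of "tl w", unfolded computes_def]
    by (subst computes_alg_iff) (auto simp: ev_simps drop_body_def drop_Suc)
qed

primrec rows :: "nat \<Rightarrow> nat \<Rightarrow> bool list \<Rightarrow> bool list list" where
  "rows 0 n w = []"
| "rows (Suc m) n w = take n w # rows m n (drop n w)"

lemma computes_rows:
  "computes (alg g Y) rows_fn [nat_val m, nat_val n, word_val w] (mat_val (rows m n w))
    (200 * (m + 1) * (n + 1))"
proof (induction m arbitrary: w)
  case 0
  show ?case by (subst computes_alg_iff) (auto simp: ev_simps rows_body_def)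
next
  case (Suc m)
  show ?case
    using Suc.IH[of "drop n w", unfolded computes_def] computes_take[of g Y n w, unfolded
        computes_def]
      computes_drop[of g Y n w, unfolded computes_def]
    by (subst computes_alg_iff) (auto simp: ev_simps rows_body_def algebra_simps)
qed

text \<open>Removing \<open>n\<close> entries \<open>m\<close> times spares the program a
  multiplication.\<close>

lemma computes_drops:
  "computes (alg g Y) drops_fn [nat_val m, nat_val n, word_val w] (word_val (drop (m * n) w))
    (200 * (m + 1) * (n + 1))"
proof (induction m arbitrary: w)
  case 0
  show ?case by (subst computes_alg_iff) (auto simp: ev_simps drops_body_def)
next
  case (Suc m)
  show ?case
    using Suc.IH[of "drop n w", unfolded computes_def]
      computes_drop[of g Y n w, unfolded computes_def]
    by (subst computes_alg_iff) (auto simp: ev_simps drops_body_def algebra_simps)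
qed

lemma computes_heads:
  assumes "[] \<notin> set M"
  shows "computes (alg g Y) heads_fn [mat_val M] (word_val (map hd M)) (40 * (length M + 1))"
  using assms
proof (induction M)
  case Nil
  show ?case by (subst computes_alg_iff) (auto simp: ev_simps heads_body_def)
next
  case (Cons r M)
  then have "[] \<notin> set M" and "r \<noteq> []"
    by auto
  from Cons.IH[OF this(1), unfolded computes_def] this(2) show ?case
    by (subst computes_alg_iff) (auto simp: ev_simps heads_body_def neq_Nil_conv)
qed

lemma computes_tails:
  "computes (alg g Y) tails_fn [mat_val M] (mat_val (map tl M)) (40 * (length M + 1))"
proof (induction M)
  case Nil
  show ?case by (subst computes_alg_iff) (auto simp: ev_simps tails_body_def)
next
  case (Cons r M)
  from Cons.IH[unfolded computes_def] show ?case
    by (subst computes_alg_iff) (auto simp: ev_simps tails_body_def)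
qed

section \<open>Symmetry of the matrix, and the assembled search\<close>

function symm :: "bool list list \<Rightarrow> bool" where
  "symm [] \<longleftrightarrow> True"
| "symm (r # M) \<longleftrightarrow> \<not> hd r \<and> tl r = map hd M \<and> symm (map tl M)"
  by pat_completeness auto
termination by (relation "measure length") auto

lemma square_Cons:
  assumes "square n (r # M)"
  obtains m b r' where "n = Suc m" "r = b # r'" "length r' = m" "length M = m" "[] \<notin> set M"
    "square m (map tl M)"
proof -
  from assms obtain m where "n = Suc m"
    by (auto simp: square_def)
  with assms show ?thesis
    by (intro that[of m "hd r" "tl r"]) (cases r; force simp: square_def)+
qed

lemma computes_sym:
  assumes "square n M"
  shows "computes (alg g Y) sym_fn [mat_val M] (bool_val (symm M)) (600 * (n + 1) * (n + 1))"
  using assms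
proof (induction M arbitrary: n rule: symm.induct)
  case 1
  show ?case by (subst computes_alg_iff) (auto simp: ev_simps sym_body_def)
next
  case (2 r M)
  from square_Cons[OF "2.prems"] obtain m b r' where m: "n = Suc m" "r = b # r'" "length r' = m"
    "length M = m" "[] \<notin> set M" "square m (map tl M)" .
  have IH: "computes (alg g Y) sym_fn [mat_val (map tl M)] (bool_val (symm (map tl M)))
    (600 * (m + 1) * (m + 1))"
    using "2.IH" m(6) by blast
  obtain t1 where t1: "fcall (alg g Y) sym_fn [mat_val (map tl M)] = Some (bool_val (symm
      (map tl M)), t1)"
    "t1 \<le> 600 * (m + 1) * (m + 1)" using IH[unfolded computes_def] by blast
  obtain t2 where t2: "fcall (alg g Y) heads_fn [mat_val M] = Some (word_val (map hd M), t2)"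
    "t2 \<le> 40 * (m + 1)" using computes_heads[OF m(5), of g Y, unfolded computes_def] m(4) by blast
  obtain t3 where t3: "fcall (alg g Y) tails_fn [mat_val M] = Some (mat_val (map tl M), t3)"
    "t3 \<le> 40 * (m + 1)" using computes_tails[of g Y M, unfolded computes_def] m(4) by blast
  obtain t4 where t4: "fcall (alg g Y) eq_fn [word_val r', word_val (map hd M)] = Some (bool_val
      (r' = map hd M), t4)"
    "t4 \<le> 400 * (m + 1)" using computes_eq[of r' "map hd M" g Y, unfolded computes_def] m(3,4)
        by auto
  show ?case
   unfolding m(1,2)
    by (subst computes_alg_iff, cases b; cases "r' = map hd M")
      (use t1 t2 t3 t4 in \<open>simp_all add: ev_simps sym_body_def algebra_simps\<close>)
qed

text \<open>The vector \<open>nbh M (high M) (high M)\<close> marks the vertices outside the components with at most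
  two vertices; \<open>trunc k\<close> selects the first \<open>k\<close> vertices of its complement.\<close>

definition region :: "bool list list \<Rightarrow> nat \<Rightarrow> bool list \<Rightarrow> bool list \<Rightarrow> bool list" where
  "region M k S T = join T (join (trunc k (nbh M (high M) (high M))) (nbh M (nbh M S S)
      (nbh M S S)))"

lemma length_nbh [simp]: "length (nbh M A B) = min (length M) (length A)"
  by (simp add: nbh_def)

lemma length_high [simp]: "length (high M) = length M"
  by (simp add: high_def)

lemma computes_region:
  assumes "square n M" "length S = n" "length T = n"
  shows "computes (alg g Y) region_fn [mat_val M, nat_val k, word_val S, word_val T]
    (word_val (region M k S T)) (1000 * (n + 1) * (n + 1))"
proof -
  note M = assms(1)[unfolded square_def]
  note h = computes_high[of M n g Y, unfolded computes_def]
  note nb = computes_nb[of M "high M" "high M" g Y, unfolded computes_def]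
    computes_nb[of M S S g Y, unfolded computes_def]
    computes_nb[of M "nbh M S S" "nbh M S S" g Y, unfolded computes_def]
  note rest = computes_trunc[of g Y k "nbh M (high M) (high M)", unfolded computes_def]
    computes_join[of "trunc k (nbh M (high M) (high M))" "nbh M (nbh M S S)
        (nbh M S S)" g Y, unfolded computes_def]
    computes_join[of T "join (trunc k (nbh M (high M) (high M))) (nbh M (nbh M S S)
        (nbh M S S))" g Y, unfolded computes_def]
  show ?thesis
    using h nb rest M assms(2,3)
    by (subst computes_alg_iff) (auto simp: ev_simps region_body_def region_def algebra_simps)
qed

definition candidates :: "bool \<Rightarrow> bool list list \<Rightarrow> nat \<Rightarrow> bool list \<Rightarrow> bool list \<Rightarrow> bool list list"
    where
  "candidates g M k S T = filter (ok g M k) (subvectors (region M k S T))"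

definition solve :: "bool \<Rightarrow> reconf_rule \<Rightarrow> nat \<Rightarrow> bool list list \<Rightarrow> bool list \<Rightarrow> bool list \<Rightarrow> bool" where
  "solve g Y k M S T =
     (let C = candidates g M k S T in reach Y M T C (length C) S)"

lemma length_in_subvectors: "A \<in> set (subvectors us) \<Longrightarrow> length A = length us"
  by (induction us arbitrary: A) (auto simp: branch_def split: if_splits)

text \<open>The bound is in terms of the number \<open>m\<close> of subsets of the region, for
  arbitrary vectors of the right length. Only \<open>length_subvectors_region_le\<close>, which
  needs the source to be a small alliance, turns it into a function of \<open>k\<close>.\<close>

lemma computes_solve:
  fixes k :: nat
  assumes M: "square n M" and S: "length S = n" and T: "length T = n"
  defines "m \<equiv> length (subvectors (region M k S T))"
  shows "computes (alg g Y) solve_fn [nat_val k, mat_val M, word_val S, word_val T]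
    (bool_val (solve g Y k M S T)) (5000 * (n + 1) * (n + 1) * (2 * (m + 2)) ^ (m + 1))"
proof -
  define C where "C = candidates g M k S T"
  define R where "R = (2 * (m + 2)) ^ (m + 1)"
  have len: "length (region M k S T) = n"
    using assms by (simp add: region_def square_def)
  then have sub: "\<forall>A\<in>set (subvectors (region M k S T)). length A = n"
    by (auto dest: length_in_subvectors)
  then have C: "\<forall>A\<in>set C. length A = n"
    by (auto simp: C_def candidates_def)
  have Cm: "length C \<le> m"
    by (simp add: C_def candidates_def m_def)
  have "(2 * (length C + 2)) ^ (length C + 1) \<le> (2 * (m + 2)) ^ (length C + 1)"
    using Cm by (intro power_mono) auto
  also have "\<dots> \<le> R"
    unfolding R_def using Cm by (intro power_increasing) auto
  finally have CR: "(2 * (length C + 2)) ^ (length C + 1) \<le> R" .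
  have reach: "computes (alg g Y) reach_fn [mat_val C, word_val S, word_val T, mat_val C, mat_val M]
      (bool_val (solve g Y k M S T)) (2000 * (n + 1) * (n + 1) * R)"
    using computes_mono[OF computes_reach[OF M T C S, of g Y C] mult_le_mono2[OF CR]]
    by (simp add: solve_def Let_def C_def)
  then have search: "computes (alg g Y) search_fn [mat_val M, word_val S, word_val T, mat_val C]
      (bool_val (solve g Y k M S T)) (2000 * (n + 1) * (n + 1) * R + 40)"
    unfolding computes_def[of _ reach_fn] by (subst computes_alg_iff)
        (auto simp: ev_simps search_body_def)
  have "m + 2 \<le> R"
  proof -
    have "m + 2 \<le> (2 * (m + 2)) ^ 1"
      by simp
    also have "\<dots> \<le> R"
      unfolding R_def by (intro power_increasing) auto
    finally show ?thesis .
  qed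
  define N where "N = n + 1"
  have "N * m \<le> N * N * m" "1 \<le> N * N"
    by (simp_all add: N_def)
  \<comment> \<open>The summands are the costs of the region, of listing its subsets, of filtering
    them, and of the remaining overhead. Together they are at most
    \<open>2000 * N * N * (m + 2)\<close>, which \<open>m + 2 \<le> R\<close> places below the cost
    of the search.\<close>
  have "1000 * N * N + 300 * N * m + 700 * (m + 1) * N * N + 100 =
      1700 * (N * N) + 300 * (N * m) + 700 * (N * N * m) + 100"
    by (simp add: algebra_simps)
  also have "\<dots> \<le> 4000 * (N * N) + 2000 * (N * N * m)"
    using \<open>N * m \<le> N * N * m\<close> \<open>1 \<le> N * N\<close> by linarith
  also have "\<dots> = 2000 * N * N * (m + 2)"
    by (simp add: algebra_simps)
  also have "\<dots> \<le> 2000 * N * N * R"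
    using \<open>m + 2 \<le> R\<close> by (intro mult_le_mono) auto
  finally have bnd: "1000 * N * N + 300 * N * m + 700 * (m + 1) * N * N + 100 + 2000 * N * N * R
    \<le> 5000 * N * N * R"
    by linarith
  have "computes (alg g Y) solve_fn [nat_val k, mat_val M, word_val S, word_val T]
    (bool_val (solve g Y k M S T))
    (1000 * N * N + 300 * N * m + 700 * (m + 1) * N * N + 100 + 2000 * N * N * R)"
    using search[folded N_def, unfolded computes_def]
      computes_region[OF M S T, of g Y k, folded N_def, unfolded computes_def]
      computes_filt[OF M sub, of g Y k, folded C_def[unfolded candidates_def] m_def N_def,
          unfolded computes_def]
      computes_subsets[of g Y "region M k S T", unfolded len, folded m_def N_def, unfolded
          computes_def]
    by (subst computes_alg_iff) (auto simp: ev_simps solve_body_def)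
  then show ?thesis
    using bnd unfolding N_def R_def by (rule computes_mono)
qed

lemma computes_sizes:
  assumes "length S = n" "length T = n"
  shows "computes (alg g Y) sizes_fn [nat_val k, word_val S, word_val T]
    (bool_val (Y \<noteq> TAR \<longrightarrow> k \<le> cnt S S \<and> k \<le> cnt T T)) (100 * (k + 1) + 100 * (n + 1))"
  using computes_le_nat[of g Y k "cnt S S", unfolded computes_def]
    computes_le_nat[of g Y k "cnt T T", unfolded computes_def]
    computes_cnt[of S S g Y, unfolded computes_def]
    computes_cnt[of T T g Y, unfolded computes_def] assms
  by (subst computes_alg_iff) (auto simp: ev_simps sizes_body_def)

lemma computes_le_word:
  "computes (alg g Y) le_fn [word_val w, nat_val n] (bool_val (length w \<le> n)) (40 * (length w + 1))"
  "computes (alg g Y) le_fn [nat_val n, word_val w] (bool_val (n \<le> length w)) (40 * (n + 1))"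
  using computes_le[of g Y "map bool_val w" "replicate n Leaf"]
    computes_le[of g Y "replicate n Leaf" "map bool_val w"]
  by (simp_all add: nat_val_def word_val_def)

definition check :: "bool \<Rightarrow> reconf_rule \<Rightarrow> nat \<Rightarrow> nat \<Rightarrow> bool list list \<Rightarrow> bool list \<Rightarrow> bool list \<Rightarrow> bool"
  where
  "check g Y k n M S T \<longleftrightarrow>
     length T = n \<and> symm M \<and> ok g M k S \<and> ok g M k T \<and>
     (Y \<noteq> TAR \<longrightarrow> k \<le> cnt S S \<and> k \<le> cnt T T) \<and> solve g Y k M S T"

text \<open>The bound \<open>D\<close> on the search is assumed only under the outcomes of earlier
  tests, because an input that fails one of them never reaches \<open>solve_fn\<close>.\<close>

lemma computes_check:
  assumes wf: "length T = n \<Longrightarrow> square n M \<and> length S = n"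
    and D: "length T = n \<Longrightarrow> symm M \<Longrightarrow> ok g M k S \<Longrightarrow> ok g M k T \<Longrightarrow>
      computes (alg g Y) solve_fn [nat_val k, mat_val M, word_val S, word_val T]
        (bool_val (solve g Y k M S T)) D"
  shows "computes (alg g Y) check_fn [nat_val k, nat_val n, mat_val M, word_val S, word_val T]
    (bool_val (check g Y k n M S T))
    (40 * (length T + 1) + 3000 * (n + 1) * (n + 1) + 100 * (k + 1) + D)"
proof -
  obtain t1 t2 where
    le: "fcall (alg g Y) le_fn [word_val T, nat_val n] = Some (bool_val (length T \<le> n), t1)"
      "fcall (alg g Y) le_fn [nat_val n, word_val T] = Some (bool_val (n \<le> length T), t2)"
    and le_time: "t1 \<le> 40 * (length T + 1)" "t2 \<le> 40 * (n + 1)"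
    using computes_le_word(1)[of g Y T n] computes_le_word(2)[of g Y n T] unfolding computes_def
        by blast
  define K where "K = 600 * (n + 1) * (n + 1)"
  have K: "300 * (n + 1) \<le> K"
    by (simp add: K_def)
  have goal: "40 * (length T + 1) + 3000 * (n + 1) * (n + 1) + 100 * (k + 1) + D =
      40 * (length T + 1) + 5 * K + 100 * (k + 1) + D"
    by (simp add: K_def)
  show ?thesis
  proof (cases "length T = n")
    case False
    show ?thesis
      unfolding goal
      by (subst computes_alg_iff, cases "length T \<le> n")
        (use le le_time K False in \<open>simp_all add: ev_simps check_body_def check_def\<close>)
  next
    case T: True
    with wf have M: "square n M" and S: "length S = n"
      by auto
    obtain t3 t4 t5 t6 where
      c: "fcall (alg g Y) sym_fn [mat_val M] = Some (bool_val (symm M), t3)"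
        "fcall (alg g Y) ok_fn [mat_val M, nat_val k, word_val S] = Some (bool_val
            (ok g M k S), t4)"
        "fcall (alg g Y) ok_fn [mat_val M, nat_val k, word_val T] = Some (bool_val
            (ok g M k T), t5)"
        "fcall (alg g Y) sizes_fn [nat_val k, word_val S, word_val T] =
          Some (bool_val (Y \<noteq> TAR \<longrightarrow> k \<le> cnt S S \<and> k \<le> cnt T T), t6)"
      and c_time: "t3 \<le> K" "t4 \<le> K" "t5 \<le> K" "t6 \<le> 100 * (k + 1) + 100 * (n + 1)"
      using computes_sym[OF M, of g Y] computes_ok[OF M S, of g Y k] computes_ok[OF M T, of g Y k]
        computes_sizes[OF S T, of g Y k]
      unfolding computes_def K_def by blast
    define s where "s \<longleftrightarrow> (Y \<noteq> TAR \<longrightarrow> k \<le> cnt S S \<and> k \<le> cnt T T)"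
    note c' = c[folded s_def]
    have chk: "check g Y k n M S T \<longleftrightarrow> symm M \<and> ok g M k S \<and> ok g M k T \<and> s \<and> solve g Y k M S T"
      using T by (simp add: check_def s_def)
    show ?thesis
    proof (cases "symm M \<and> ok g M k S \<and> ok g M k T")
      case True
      obtain t7 where d: "fcall (alg g Y) solve_fn [nat_val k, mat_val M, word_val S, word_val T] =
          Some (bool_val (solve g Y k M S T), t7)" and d_time: "t7 \<le> D"
        using D[OF T] True unfolding computes_def by blast
      show ?thesis
        unfolding goal chk
        by (subst computes_alg_iff, cases s)
          (use le le_time K T c' c_time True d d_time in \<open>simp_all add: ev_simps check_body_def\<close>)
    next
      case False
      show ?thesis
        unfolding goal chk
        by (subst computes_alg_iff, cases "symm M"; cases "ok g M k S"; cases "ok g M k T")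
          (use le le_time K T c' c_time False in \<open>simp_all add: ev_simps check_body_def\<close>)
    qed
  qed
qed

section \<open>Decoding arbitrary words, and the complete run\<close>

definition size_of :: "bool list \<Rightarrow> nat" where
  "size_of w = length (takeWhile id w)"

definition payload :: "bool list \<Rightarrow> bool list" where
  "payload w = tl (dropWhile id w)"

definition matrix_of :: "bool list \<Rightarrow> bool list list" where
  "matrix_of w = rows (size_of w) (size_of w) (payload w)"

definition source_of :: "bool list \<Rightarrow> bool list" where
  "source_of w = take (size_of w) (drop (size_of w * size_of w) (payload w))"

definition target_of :: "bool list \<Rightarrow> bool list" where
  "target_of w = drop (size_of w) (drop (size_of w * size_of w) (payload w))"

definition accepts :: "bool \<Rightarrow> reconf_rule \<Rightarrow> bool list \<Rightarrow> nat \<Rightarrow> bool" where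
  "accepts g Y w k \<longleftrightarrow> dropWhile id w \<noteq> [] \<and>
     check g Y k (size_of w) (matrix_of w) (source_of w) (target_of w)"

lemma length_rows [simp]: "length (rows m n w) = m"
  by (induction m arbitrary: w) auto

lemma rows_lengths: "m * n \<le> length w \<Longrightarrow> r \<in> set (rows m n w) \<Longrightarrow> length r = n"
proof (induction m arbitrary: w)
  case (Suc m)
  from Suc.IH[of "drop n w"] Suc.prems show ?case
    by auto
qed simp

text \<open>The decoders are total and may return rows that are too short. For positive size,
  however, a payload that is too short leaves an empty target, so the correct target length
  certifies that the matrix and the source are complete. For size zero the claim is
  immediate.\<close>

lemma square_matrix_of:
  assumes "length (target_of w) = size_of w"
  shows "square (size_of w) (matrix_of w)" "length (source_of w) = size_of w"
proof -
  have "size_of w * size_of w + size_of w \<le> length (payload w)"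
  proof (cases "size_of w = 0")
    case False
    then show ?thesis
      using assms by (simp add: target_of_def)
  qed simp
  then show "square (size_of w) (matrix_of w)" "length (source_of w) = size_of w"
    by (auto simp: square_def matrix_of_def source_of_def intro!: rows_lengths)
qed

lemma size_of_le: "size_of w \<le> length w"
  unfolding size_of_def by (rule length_takeWhile_le)

lemma length_target_of_le: "length (target_of w) \<le> length w"
proof -
  have "length (dropWhile id w) \<le> length w"
    by (rule length_dropWhile_le)
  then show ?thesis
    by (simp add: target_of_def payload_def)
qed

lemma computes_main:
  assumes D: "length (target_of w) = size_of w \<Longrightarrow> symm (matrix_of w) \<Longrightarrow>
      ok g (matrix_of w) k (source_of w) \<Longrightarrow> ok g (matrix_of w) k (target_of w) \<Longrightarrow>
      computes (alg g Y) solve_fn [nat_val k, mat_val (matrix_of w), word_val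
          (source_of w), word_val (target_of w)]
        (bool_val (solve g Y k (matrix_of w) (source_of w) (target_of w))) D"
  shows "computes (alg g Y) main_fn [word_val w, nat_val k] (bool_val (accepts g Y w k))
    (5000 * (length w + 1) ^ 2 + 100 * (k + 1) + D)"
proof -
  define N where "N = length w + 1"
  define C where "C = 40 * N + 3000 * N * N + 100 * (k + 1) + D"
  define n where "n = size_of w"
  define p where "p = payload w"
  have n: "n + 1 \<le> N"
    using size_of_le[of w] by (simp add: n_def N_def)
  define q where "q = drop (n * n) p"
  define M where "M = matrix_of w"
  define S where "S = source_of w"
  define T where "T = target_of w"
  define b where "b = check g Y k n M S T"
  note D' = D[folded n_def M_def S_def T_def]
  have wf: "length T = n \<Longrightarrow> square n M \<and> length S = n"
    unfolding T_def n_def M_def S_def using square_matrix_of by blast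
  have parts: "rows n n p = M" "take n q = S" "drop n q = T"
    by (simp_all only: M_def S_def T_def q_def p_def n_def matrix_of_def source_of_def
        target_of_def)
  have "40 * (length T + 1) + 3000 * (n + 1) * (n + 1) + 100 * (k + 1) + D \<le> C"
    unfolding C_def using n length_target_of_le[of w]
    by (intro add_mono mult_le_mono order_refl) (auto simp: N_def T_def)
  from computes_mono[OF computes_check[OF wf D'] this]
  obtain t1 where t1: "fcall (alg g Y) check_fn [nat_val k, nat_val n, mat_val M, word_val S,
      word_val T] =
      Some (bool_val b, t1)" "t1 \<le> C"
    unfolding computes_def b_def by blast
  obtain t2 t3 where t2: "fcall (alg g Y) take_fn [nat_val n, word_val q] = Some (word_val S, t2)"
      "fcall (alg g Y) drop_fn [nat_val n, word_val q] = Some (word_val T, t3)"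
      "t2 \<le> 40 * (n + 1)" "t3 \<le> 40 * (n + 1)"
    using computes_take[of g Y n q] computes_drop[of g Y n q] unfolding computes_def parts by blast
  have "computes (alg g Y) halve_fn [nat_val k, nat_val n, mat_val M, word_val q] (bool_val b)
      (100 * N + C)"
    by (subst computes_alg_iff) (use n t1 t2 in \<open>simp add: ev_simps halve_body_def\<close>)
  then obtain t4 where t4: "fcall (alg g Y) halve_fn [nat_val k, nat_val n, mat_val M, word_val q] =
      Some (bool_val b, t4)" "t4 \<le> 100 * N + C"
    unfolding computes_def by blast
  define K where "K = (n + 1) * (n + 1)"
  obtain t5 t6 where t5: "fcall (alg g Y) rows_fn [nat_val n, nat_val n, word_val p] = Some
      (mat_val M, t5)"
      "fcall (alg g Y) drops_fn [nat_val n, nat_val n, word_val p] = Some (word_val q, t6)"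
      "t5 \<le> 200 * K" "t6 \<le> 200 * K"
    using computes_rows[of g Y n n p] computes_drops[of g Y n n p]
    unfolding computes_def parts q_def[symmetric] K_def mult.assoc by blast
  have "K \<le> N * N"
    unfolding K_def using n by (intro mult_le_mono) auto
  then have "computes (alg g Y) split_fn [nat_val k, nat_val n, word_val p] (bool_val b)
      (400 * (N * N) + 200 * N + C)"
    by (subst computes_alg_iff) (use n t4 t5 in \<open>simp add: ev_simps split_body_def\<close>)
  then obtain t7 where t7: "fcall (alg g Y) (Suc 0) [nat_val k, nat_val n, word_val p] =
      Some (bool_val b, t7)" "t7 \<le> 400 * (N * N) + 200 * N + C"
    unfolding computes_def One_nat_def by blast
  obtain t8 t9 where t8: "fcall (alg g Y) dropw_fn [word_val w] = Some (word_val
      (dropWhile id w), t8)"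
      "fcall (alg g Y) num_fn [word_val w] = Some (nat_val n, t9)" "t8 \<le> 40 * N" "t9 \<le> 40 * N"
    using computes_dropw[of g Y w] computes_num[of g Y w]
    unfolding computes_def N_def n_def size_of_def by blast
  have p: "tl (dropWhile id w) = p"
    by (simp add: p_def payload_def)
  have "accepts g Y w k \<longleftrightarrow> dropWhile id w \<noteq> [] \<and> b"
    by (simp add: accepts_def b_def n_def M_def S_def T_def)
  then have "computes (alg g Y) main_fn [word_val w, nat_val k] (bool_val (accepts g Y w k))
    (400 * (N * N) + 400 * N + C)"
    by (subst computes_alg_iff, cases "dropWhile id w = []")
      (use n t7 t8 p in \<open>auto simp: ev_simps main_body_def\<close>)
  moreover have "400 * (N * N) + 400 * N + C \<le> 5000 * N ^ 2 + 100 * (k + 1) + D"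
  proof -
    have "N * 1 \<le> N * N"
      by (intro mult_le_mono) (auto simp: N_def)
    then show ?thesis
      by (simp add: C_def power2_eq_square)
  qed
  ultimately show ?thesis
    unfolding N_def by (rule computes_mono)
qed

section \<open>Reconfiguration of powerful alliances\<close>

definition degree :: "'a pair_pre_digraph \<Rightarrow> 'a \<Rightarrow> nat" where
  "degree G v = card (neighbours G v)"

definition core :: "'a pair_pre_digraph \<Rightarrow> 'a set \<Rightarrow> 'a set" where
  "core G A = {v \<in> closed_nbhd G A. 2 \<le> degree G v}"

text \<open>Neither the vertex nor any neighbour has degree at least two: these are exactly the
  vertices of components with one or two vertices.\<close>

definition free :: "'a pair_pre_digraph \<Rightarrow> 'a set" where
  "free G = pverts G - closed_nbhd G {v \<in> pverts G. 2 \<le> degree G v}"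

lemma subset_closed_nbhd: "A \<subseteq> closed_nbhd G A"
  by (auto simp: closed_nbhd_def)

section \<open>Degrees in alliances and the invariant core\<close>

context pair_graph
begin

lemma neighbours_sym: "u \<in> neighbours G v \<longleftrightarrow> v \<in> neighbours G u"
  using pair_sym_arcs by (auto simp: neighbours_def symmetric_def sym_def)

lemma neighbours_irrefl: "v \<notin> neighbours G v"
  using pair_no_loops by (fastforce simp: neighbours_def)

lemma neighbours_subset: "neighbours G v \<subseteq> pverts G"
  using in_arcsD2 by (auto simp: neighbours_def)

lemma finite_neighbours [simp]: "finite (neighbours G v)"
  using neighbours_subset pair_finite_verts by (rule finite_subset)

lemma closed_nbhd_subset: "A \<subseteq> pverts G \<Longrightarrow> closed_nbhd G A \<subseteq> pverts G"
  using neighbours_subset by (auto simp: closed_nbhd_def)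

lemma closed_nbhd_iff: "x \<in> closed_nbhd G A \<longleftrightarrow> x \<in> A \<or> neighbours G x \<inter> A \<noteq> {}"
  using neighbours_sym by (auto simp: closed_nbhd_def)

lemma degree_split: "degree G v = deg_in G A v + deg_in G (pverts G - A) v"
proof -
  have "neighbours G v = (neighbours G v \<inter> A) \<union> (neighbours G v \<inter> (pverts G - A))"
    using neighbours_subset by auto
  then have "degree G v = card ((neighbours G v \<inter> A) \<union> (neighbours G v \<inter> (pverts G - A)))"
    by (simp add: degree_def)
  also have "\<dots> = deg_in G A v + deg_in G (pverts G - A) v"
    unfolding deg_in_def by (rule card_Un_disjoint) auto
  finally show ?thesis .
qed

text \<open>The outer degree is the degree minus the inner degree. Both conditions thereby become
  upper bounds on the degree in terms of the inner degree, which is what the degree arguments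
  use.\<close>

lemma powerful_alliance_iff:
  "powerful_alliance G A \<longleftrightarrow> A \<subseteq> pverts G \<and>
     (\<forall>v\<in>A. degree G v \<le> 2 * deg_in G A v + 1) \<and>
     (\<forall>v\<in>boundary G A. degree G v + 1 \<le> 2 * deg_in G A v)"
  unfolding powerful_alliance_def using degree_split[of _ A] by auto

lemma powerful_alliance_finite: "powerful_alliance G A \<Longrightarrow> finite A"
  using pair_finite_verts by (auto simp: powerful_alliance_def intro: finite_subset)

lemma deg_in_le: "finite A \<Longrightarrow> deg_in G A v \<le> card A"
  unfolding deg_in_def by (intro card_mono) auto

lemma alliance_degree:
  assumes "powerful_alliance G A" "v \<in> closed_nbhd G A"
  shows "degree G v \<le> 2 * card A + 1"
proof -
  have "degree G v \<le> 2 * deg_in G A v + 1"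
  proof (cases "v \<in> A")
    case False
    with assms(2) have "v \<in> boundary G A"
      by (simp add: boundary_def)
    then have "degree G v + 1 \<le> 2 * deg_in G A v"
      using assms(1) unfolding powerful_alliance_iff by blast
    then show ?thesis
      by simp
  qed (use assms(1) in \<open>simp add: powerful_alliance_iff\<close>)
  then show ?thesis
    using deg_in_le[OF powerful_alliance_finite[OF assms(1)], of v] by linarith
qed

lemma card_closed_nbhd_le:
  assumes "finite B" "\<And>v. v \<in> B \<Longrightarrow> degree G v \<le> d"
  shows "card (closed_nbhd G B) \<le> card B * (d + 1)"
proof -
  have "closed_nbhd G B = (\<Union>v\<in>B. insert v (neighbours G v))"
    by (auto simp: closed_nbhd_def)
  also have "card \<dots> \<le> (\<Sum>v\<in>B. card (insert v (neighbours G v)))"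
    using assms(1) by (rule card_UN_le)
  also have "\<dots> \<le> (\<Sum>v\<in>B. d + 1)"
    using assms(2) neighbours_irrefl by (intro sum_mono) (simp add: degree_def)
  finally show ?thesis
    by simp
qed

lemma card_second_nbhd_le:
  assumes "powerful_alliance G A" "card A \<le> k"
  shows "card (closed_nbhd G (closed_nbhd G A)) \<le> k * (2 * k + 2) * (2 * k + 2)"
proof -
  have fin: "finite A"
    using assms(1) by (rule powerful_alliance_finite)
  have deg: "degree G v \<le> 2 * k + 1" if "v \<in> closed_nbhd G A" for v
    using alliance_degree[OF assms(1) that] assms(2) by linarith
  have "finite (closed_nbhd G A)"
    using fin by (simp add: closed_nbhd_def)
  then have "card (closed_nbhd G (closed_nbhd G A)) \<le> card (closed_nbhd G A) * (2 * k + 2)"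
    using card_closed_nbhd_le[of "closed_nbhd G A" "2 * k + 1"] deg by simp
  moreover have "card (closed_nbhd G A) \<le> k * (2 * k + 2)"
  proof -
    have "card (closed_nbhd G A) \<le> card A * (2 * k + 2)"
      using card_closed_nbhd_le[of A "2 * k + 1"] fin deg subset_closed_nbhd[of A G] by force
    also have "\<dots> \<le> k * (2 * k + 2)"
      using assms(2) by (rule mult_le_mono1)
    finally show ?thesis .
  qed
  then have "card (closed_nbhd G A) * (2 * k + 2) \<le> k * (2 * k + 2) * (2 * k + 2)"
    by (rule mult_le_mono1)
  ultimately show ?thesis
    by (rule order_trans)
qed

text \<open>A vertex that enters \<open>N[B]\<close> through the single new token \<open>w\<close> has at most one neighbour
  in \<open>B\<close>, and the alliance inequalities then leave it no second neighbour at all.\<close>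

lemma core_mono_step:
  assumes B: "powerful_alliance G B" and sub: "B \<subseteq> insert w A"
  shows "core G B \<subseteq> core G A"
proof
  fix x
  assume x: "x \<in> core G B"
  then have xB: "x \<in> closed_nbhd G B" and deg: "2 \<le> degree G x"
    by (auto simp: core_def)
  have "x \<in> closed_nbhd G A"
  proof (rule ccontr)
    assume "x \<notin> closed_nbhd G A"
    then have new: "x \<notin> A" "neighbours G x \<inter> B \<subseteq> {w}"
      using sub by (auto simp: closed_nbhd_iff)
    show False
    proof (cases "x \<in> B")
      case True
      \<comment> \<open>Here \<open>x\<close> is the new token \<open>w\<close> itself, so
        irreflexivity leaves it no neighbour in \<open>B\<close>.\<close>
      with new sub have "neighbours G x \<inter> B = {}"
        using neighbours_irrefl[of x] by auto
      then have "deg_in G B x = 0"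
        by (simp add: deg_in_def)
      with B True deg show False
        by (auto simp: powerful_alliance_iff)
    next
      case False
      have "deg_in G B x \<le> card {w}"
        unfolding deg_in_def using new(2) by (intro card_mono) auto
      moreover have "degree G x + 1 \<le> 2 * deg_in G B x"
        using B False xB by (auto simp: powerful_alliance_iff boundary_def)
      ultimately show False
        using deg by simp
    qed
  qed
  with deg show "x \<in> core G A"
    by (simp add: core_def)
qed

text \<open>By definition of \<open>free\<close>, both ends of the edge have degree one, so the edge
  is a component by itself.\<close>

lemma free_neighbours:
  assumes "v \<in> free G" "u \<in> neighbours G v"
  shows "neighbours G v = {u}" "neighbours G u = {v}" "u \<in> free G"
proof -
  have deg1: "neighbours G x = {y}" if "y \<in> neighbours G x" "\<not> 2 \<le> degree G x" for x y
  proof -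
    have "card (neighbours G x) \<le> card {y}"
      using that(2) by (simp add: degree_def)
    with that(1) show ?thesis
      using card_subset_eq[of "neighbours G x" "{y}"] card_mono[of "neighbours G x" "{y}"]
      by (metis card_subset_eq empty_subsetI finite_neighbours insert_subset le_antisym)
  qed
  have uV: "u \<in> pverts G" "v \<in> pverts G"
    using assms neighbours_subset neighbours_sym by blast+
  from assms have "\<not> 2 \<le> degree G v" "\<not> 2 \<le> degree G u"
    using uV by (auto simp: free_def closed_nbhd_iff)
  then show v: "neighbours G v = {u}" and u: "neighbours G u = {v}"
    using deg1 assms(2) neighbours_sym by blast+
  show "u \<in> free G"
    using \<open>\<not> 2 \<le> degree G u\<close> \<open>\<not> 2 \<le> degree G v\<close> uV u by (auto simp: free_def closed_nbhd_iff)
qed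

lemma free_degree: "v \<in> free G \<Longrightarrow> degree G v \<le> 1"
  by (auto simp: free_def closed_nbhd_iff)

text \<open>A token outside \<open>free G\<close> is, or is adjacent to, a vertex of degree at least
  two. That vertex belongs to the core of \<open>A\<close> and hence to \<open>N[S]\<close>, which
  places the token in the second closed neighbourhood.\<close>

lemma non_free_subset:
  assumes A: "A \<subseteq> pverts G" and core: "core G A \<subseteq> closed_nbhd G S"
  shows "A - free G \<subseteq> closed_nbhd G (closed_nbhd G S)"
proof
  fix v
  assume v: "v \<in> A - free G"
  then have "v \<in> closed_nbhd G {v \<in> pverts G. 2 \<le> degree G v}"
    using A by (auto simp: free_def)
  then obtain x where x: "x = v \<or> x \<in> neighbours G v" "2 \<le> degree G x"
    by (auto simp: closed_nbhd_iff)
  then have "x \<in> core G A"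
    using v by (auto simp: core_def closed_nbhd_def)
  then have "x \<in> closed_nbhd G S"
    using core by auto
  then show "v \<in> closed_nbhd G (closed_nbhd G S)"
    using x(1) by (auto simp: closed_nbhd_iff[of v])
qed

text \<open>No edge joins \<open>free G\<close> to its complement, so the inner degrees of all other
  vertices are unaffected. On \<open>free G\<close> the inequalities hold automatically: degrees are
  at most one, and a boundary vertex has its only neighbour in the set. Domination, in contrast, may
  be lost.\<close>

lemma powerful_alliance_change_free:
  assumes A: "powerful_alliance G A" and R: "R \<subseteq> free G"
  shows "powerful_alliance G (A - free G \<union> R)"
proof -
  let ?B = "A - free G \<union> R"
  have same: "neighbours G v \<inter> ?B = neighbours G v \<inter> A" if "v \<notin> free G" for v
  proof -
    have "neighbours G v \<inter> free G = {}"
      using that free_neighbours(3) neighbours_sym by blast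
    then show ?thesis
      using R by auto
  qed
  have sub: "?B \<subseteq> pverts G"
    using A R by (auto simp: powerful_alliance_def free_def)
  have "degree G v \<le> 2 * deg_in G ?B v + 1" if "v \<in> ?B" for v
  proof (cases "v \<in> free G")
    case True
    then show ?thesis
      using free_degree by fastforce
  next
    case False
    then show ?thesis
      using that A R same[OF False] by (auto simp: powerful_alliance_iff deg_in_def)
  qed
  moreover have "degree G v + 1 \<le> 2 * deg_in G ?B v" if "v \<in> boundary G ?B" for v
  proof (cases "v \<in> free G")
    case True
    from that obtain u where u: "u \<in> neighbours G v" "u \<in> ?B"
      by (auto simp: boundary_def closed_nbhd_iff)
    then have "neighbours G v \<inter> ?B = {u}"
      using free_neighbours(1)[OF True u(1)] by auto
    then show ?thesis
      using free_degree[OF True] by (simp add: deg_in_def)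
  next
    case False
    then have "v \<in> boundary G A"
      using that same[OF False] by (auto simp: boundary_def closed_nbhd_iff)
    then show ?thesis
      using A same[OF False] by (auto simp: powerful_alliance_iff deg_in_def)
  qed
  ultimately show ?thesis
    using sub by (simp add: powerful_alliance_iff)
qed

end

section \<open>Standard positions for interchangeable tokens\<close>

lemma tj_stepI:
  assumes "finite C" "u \<notin> C" "w \<notin> C" "u \<noteq> w"
  shows "tj_step (insert u C) (insert w C)"
proof -
  have "insert u C - insert w C = {u}"
    using assms by auto
  then show ?thesis
    using assms by (simp add: tj_step_def)
qed

lemma tj_stepE:
  assumes "tj_step A B" "finite A" "finite B"
  obtains C u w where "A = insert u C" "B = insert w C" "u \<notin> C" "w \<notin> C" "u \<noteq> w" "finite C"
proof -
  have "card (A - B) = 1" and eq: "card A = card B"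
    using assms(1) by (auto simp: tj_step_def)
  then obtain u where u: "A - B = {u}"
    by (auto simp: card_1_singleton_iff)
  have "card (B - A) = 1"
    using eq \<open>card (A - B) = 1\<close> assms(2,3) card_le_sym_Diff[of A B] card_le_sym_Diff[of B A] by simp
  then obtain w where w: "B - A = {w}"
    by (auto simp: card_1_singleton_iff)
  show ?thesis
    by (rule that[of u "A \<inter> B" w]) (use u w assms in auto)
qed

text \<open>Tokens on \<open>F\<close> are interchangeable.  Since only their number decides which elements of
  \<open>fs\<close> are used, every step is mapped to a step or to an equality.\<close>

definition normalise :: "'a list \<Rightarrow> 'a set \<Rightarrow> 'a set \<Rightarrow> 'a set" where
  "normalise fs F A = A - F \<union> set (take (card (A \<inter> F)) fs)"

lemma normalise_insert:
  assumes fs: "distinct fs" "set fs \<subseteq> F" and C: "finite C" "v \<notin> C"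
    and card: "card (insert v C \<inter> F) \<le> length fs"
  obtains x where "normalise fs F (insert v C) = insert x (normalise fs F C)" "x \<notin> normalise fs F C"
proof (cases "v \<in> F")
  case True
  let ?c = "card (C \<inter> F)"
  have "card (insert v C \<inter> F) = Suc ?c"
    using True C by (simp add: Int_insert_left)
  moreover from this card have less: "?c < length fs"
    by simp
  ultimately have "normalise fs F (insert v C) = insert (fs ! ?c) (normalise fs F C)"
    using True by (auto simp: normalise_def take_Suc_conv_app_nth)
  moreover have "fs ! ?c \<notin> set (take ?c fs)"
    using less fs(1) by (auto simp: in_set_conv_nth nth_eq_iff_index_eq)
  then have "fs ! ?c \<notin> normalise fs F C"
    using less fs(2) nth_mem by (auto simp: normalise_def)
  ultimately show ?thesis
    by (rule that)
next
  case False
  then have "normalise fs F (insert v C) = insert v (normalise fs F C)"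
    by (auto simp: normalise_def)
  moreover have "v \<notin> normalise fs F C"
    using False C(2) fs(2) by (auto simp: normalise_def dest: in_set_takeD)
  ultimately show ?thesis
    by (rule that)
qed

lemma finite_normalise: "finite A \<Longrightarrow> finite (normalise fs F A)"
  by (simp add: normalise_def)

lemma card_normalise:
  assumes "distinct fs" "set fs \<subseteq> F" "finite A" "card (A \<inter> F) \<le> length fs"
  shows "card (normalise fs F A) = card A"
proof -
  have "card (normalise fs F A) = card (A - F) + card (set (take (card (A \<inter> F)) fs))"
    unfolding normalise_def using assms(2,3) by (intro card_Un_disjoint) (auto dest: in_set_takeD)
  also have "card (set (take (card (A \<inter> F)) fs)) = card (A \<inter> F)"
    using assms(1,4) by (simp add: distinct_card)
  also have "card (A - F) + card (A \<inter> F) = card A"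
    using assms(3) card_Diff_subset_Int[of A F] card_mono[of A "A \<inter> F"] by simp
  finally show ?thesis .
qed

text \<open>A jump is a pair of insertions into a common set, so its image is a jump, or an equality
  if both images insert the same vertex. Sliding is excluded because the map forgets positions and
  with them adjacency.\<close>

lemma normalise_step:
  assumes fs: "distinct fs" "set fs \<subseteq> F" and fin: "finite A" "finite B"
    and card: "card (A \<inter> F) \<le> length fs" "card (B \<inter> F) \<le> length fs"
    and Y: "Y \<noteq> TS" and step: "reconf_step Y G A B"
  shows "normalise fs F A = normalise fs F B \<or>
    reconf_step Y G (normalise fs F A) (normalise fs F B)"
proof (cases Y)
  case TS
  with Y show ?thesis
    by simp
next
  case TJ
  with step fin obtain C u w where C: "A = insert u C" "B = insert w C" "u \<notin> C" "w \<notin> C" "finite C"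
    by (auto elim: tj_stepE)
  obtain x where x: "normalise fs F A = insert x (normalise fs F C)" "x \<notin> normalise fs F C"
    using normalise_insert[OF fs C(5,3)] card C(1) by metis
  obtain y where y: "normalise fs F B = insert y (normalise fs F C)" "y \<notin> normalise fs F C"
    using normalise_insert[OF fs C(5,4)] card C(2) by metis
  show ?thesis
    using TJ x y tj_stepI[of "normalise fs F C" x y] finite_normalise[OF C(5)] by auto
next
  case TAR
  have *: "\<exists>x. x \<notin> normalise fs F A' \<and> normalise fs F B' = insert x (normalise fs F A')"
    if "B' = insert v A'" "v \<notin> A'" "finite A'" "card (B' \<inter> F) \<le> length fs" for A' B' v
    using normalise_insert[OF fs that(3,2)] that(1,4) by metis
  from step TAR consider v where "v \<notin> A" "B = insert v A" | v where "v \<notin> B" "A = insert v B"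
    by (auto simp: tar_step_def)
  then show ?thesis
    using TAR *[of B _ A] *[of A _ B] fin card by cases (fastforce simp: tar_step_def)+
qed

section \<open>Reversibility of steps and invariance of the core\<close>

context pair_graph
begin

lemma ts_step_sym: "ts_step G A B \<Longrightarrow> ts_step G B A"
proof -
  assume step: "ts_step G A B"
  then obtain u v where "A - B = {u}" "B - A = {v}" "(u, v) \<in> parcs G" "card A = card B"
    by (auto simp: ts_step_def tj_step_def)
  moreover from this have "(v, u) \<in> parcs G"
    using neighbours_sym[of u v] by (auto simp: neighbours_def)
  ultimately show ?thesis
    by (auto simp: ts_step_def tj_step_def)
qed

lemma reconf_step_sym:
  assumes "reconf_step Y G A B" "finite A" "finite B"
  shows "reconf_step Y G B A"
proof (cases Y)
  case TJ
  with assms show ?thesis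
    by (auto elim!: tj_stepE intro!: tj_stepI)
next
  case TS
  with assms show ?thesis
    by (auto intro: ts_step_sym)
next
  case TAR
  with assms show ?thesis
    by (auto simp: tar_step_def)
qed

lemma reconf_step_one_new:
  assumes "reconf_step Y G A B" "finite A" "finite B"
  obtains w where "B \<subseteq> insert w A"
proof (cases Y)
  case TAR
  with assms that show ?thesis
    by (auto simp: tar_step_def)
next
  case TJ
  with assms that show ?thesis
    by (auto elim!: tj_stepE)
next
  case TS
  with assms have "tj_step A B"
    by (simp add: ts_step_def)
  with assms that show ?thesis
    by (auto elim!: tj_stepE)
qed

text \<open>Steps can be reversed, so the inclusion of \<open>core_mono_step\<close> applies in both
  directions.\<close>

lemma core_step_eq:
  assumes "powerful_alliance G A" "powerful_alliance G B" "reconf_step Y G A B"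
  shows "core G B = core G A"
proof -
  have fin: "finite A" "finite B"
    using assms powerful_alliance_finite by auto
  obtain w where "B \<subseteq> insert w A"
    using reconf_step_one_new[OF assms(3) fin] .
  then have "core G B \<subseteq> core G A"
    using core_mono_step assms(2) by blast
  moreover obtain w' where "A \<subseteq> insert w' B"
    using reconf_step_one_new[OF reconf_step_sym[OF assms(3) fin] fin(2,1)] .
  then have "core G A \<subseteq> core G B"
    using core_mono_step assms(1) by blast
  ultimately show ?thesis
    by simp
qed

text \<open>A free token can slide along its only edge and nowhere else.\<close>

lemma ts_step_free:
  assumes "ts_step G A B" "A \<inter> free G \<subseteq> closed_nbhd G S"
  shows "B \<inter> free G \<subseteq> closed_nbhd G S"
proof
  fix v
  assume v: "v \<in> B \<inter> free G"
  obtain u w where st: "A - B = {u}" "B - A = {w}" "(u, w) \<in> parcs G"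
    using assms(1) by (auto simp: ts_step_def)
  show "v \<in> closed_nbhd G S"
  proof (cases "v \<in> A")
    case True
    then show ?thesis
      using v assms(2) by auto
  next
    case False
    then have "v = w"
      using st v by auto
    then have "u \<in> neighbours G v"
      using st(3) neighbours_sym[of u v] by (simp add: neighbours_def)
    then have u: "u \<in> free G" "neighbours G u = {v}" "neighbours G v = {u}"
      using free_neighbours[of v u] v by auto
    then have "u \<in> closed_nbhd G S"
      using st assms(2) by auto
    then show ?thesis
      using u by (auto simp: closed_nbhd_iff)
  qed
qed

end

section \<open>Confinement of walks to a bounded region\<close>

definition confined_step ::
  "(nat pair_pre_digraph \<Rightarrow> nat set \<Rightarrow> bool) \<Rightarrow> reconf_rule \<Rightarrow> nat pair_pre_digraph \<Rightarrow> nat \<Rightarrow> nat set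
    \<Rightarrow> nat set \<Rightarrow> nat set \<Rightarrow> bool" where
  "confined_step X Y G k U A B \<longleftrightarrow> reconf_step Y G A B \<and> X G B \<and> card B \<le> k \<and> B \<subseteq> U"

lemma confined_step_mono:
  "U \<subseteq> V \<Longrightarrow> (confined_step X Y G k U)\<^sup>*\<^sup>* A B \<Longrightarrow> (confined_step X Y G k V)\<^sup>*\<^sup>* A B"
  by (erule rtranclp_mono[THEN predicate2D, rotated]) (unfold confined_step_def, blast)

text \<open>These are the properties of the region on which confinement rests: it contains the
  second neighbourhood, and it has room for the small-component tokens of every admissible set. The
  minimum is needed because there may be fewer than \<open>k\<close> free vertices.\<close>

locale bounded_reconf = pair_graph G for G :: "nat pair_pre_digraph" +
  fixes Y :: reconf_rule and k :: nat and U S :: "nat set"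
  assumes S: "powerful_alliance G S" "card S \<le> k"
    and U: "closed_nbhd G (closed_nbhd G S) \<subseteq> U" "min k (card (free G)) \<le> card (free G \<inter> U)"
begin

abbreviation good :: "nat set \<Rightarrow> bool" where
  "good A \<equiv> powerful_alliance G A \<and> card A \<le> k"

abbreviation walk :: "nat set \<Rightarrow> nat set \<Rightarrow> bool" where
  "walk \<equiv> (confined_step powerful_alliance Y G k UNIV)\<^sup>*\<^sup>*"

abbreviation walk_U :: "nat set \<Rightarrow> nat set \<Rightarrow> bool" where
  "walk_U \<equiv> (confined_step powerful_alliance Y G k U)\<^sup>*\<^sup>*"

lemma finite_free: "finite (free G)"
  using pair_finite_verts by (auto simp: free_def)

lemma walk_good:
  assumes "walk S A"
  shows "good A \<and> core G A = core G S"
  using assms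
proof induction
  case (step B C)
  then show ?case
    using core_step_eq[of B C Y] by (auto simp: confined_step_def)
qed (use S in simp)

lemma walk_non_free:
  assumes "walk S A"
  shows "A - free G \<subseteq> U"
proof -
  have "core G A \<subseteq> closed_nbhd G S" "A \<subseteq> pverts G"
    using walk_good[OF assms] by (auto simp: core_def powerful_alliance_def)
  then show ?thesis
    using non_free_subset U(1) by blast
qed

lemma walk_TS:
  assumes "Y = TS" "walk S A"
  shows "walk_U S A \<and> A \<inter> free G \<subseteq> closed_nbhd G S"
  using assms(2)
proof induction
  case base
  show ?case
    using subset_closed_nbhd[of S G] by auto
next
  case (step B C)
  then have "ts_step G B C"
    using assms(1) by (simp add: confined_step_def)
  then have C: "C \<inter> free G \<subseteq> closed_nbhd G S"
    using ts_step_free step.IH by blast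
  moreover have "walk S C"
    using step.hyps by auto
  then have "C - free G \<subseteq> U"
    by (rule walk_non_free)
  ultimately have "C \<subseteq> U"
    using U(1) subset_closed_nbhd[of "closed_nbhd G S" G] by blast
  then have "confined_step powerful_alliance Y G k U B C"
    using step.hyps(2) by (simp add: confined_step_def)
  then show ?case
    using step.IH C by auto
qed

text \<open>Under addition/removal the token is removed before the new one is placed, so the
  threshold is respected. The set in between must be an alliance as well, whence
  \<open>good C\<close>.\<close>

lemma exchange:
  assumes Y: "Y \<noteq> TS" and C: "finite C" "u \<notin> C" "w \<notin> C" "u \<noteq> w"
    and good: "good C" "good (insert w C)" and sub: "insert w C \<subseteq> U"
  shows "walk_U (insert u C) (insert w C)"
proof (cases Y)
  case TJ
  then have "confined_step powerful_alliance Y G k U (insert u C) (insert w C)"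
    using tj_stepI[OF C] good sub by (simp add: confined_step_def)
  then show ?thesis
    by (rule r_into_rtranclp)
next
  case TAR
  then have "confined_step powerful_alliance Y G k U (insert u C) C"
    "confined_step powerful_alliance Y G k U C (insert w C)"
    using C good sub by (auto simp: confined_step_def tar_step_def)
  then show ?thesis
    by (rule converse_rtranclp_into_rtranclp[OF _ r_into_rtranclp])
qed (use Y in simp)

text \<open>Each exchange trades a vertex of \<open>R - R'\<close> for one of \<open>R' - R\<close>,
  which shrinks the difference by one. All sets on the way are alliances by
  \<open>powerful_alliance_change_free\<close>.\<close>

lemma rearrange:
  assumes Y: "Y \<noteq> TS" and A: "good A" "A - free G \<subseteq> U"
    and R: "R \<subseteq> free G \<inter> U" "R' \<subseteq> free G \<inter> U" "card R = card R'" "card R = card (A \<inter> free G)"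
  shows "walk_U (A - free G \<union> R) (A - free G \<union> R')"
  using R
proof (induction "card (R - R')" arbitrary: R)
  case 0
  have "finite R" "finite R'"
    using 0 finite_free by (auto intro: finite_subset)
  with 0 have "R \<subseteq> R'"
    by simp
  with \<open>finite R'\<close> 0 have "R = R'"
    by (simp add: card_subset_eq)
  then show ?case
    by simp
next
  case (Suc d)
  have fin: "finite R" "finite R'" "finite A"
    using Suc.prems finite_free A(1) powerful_alliance_finite by (auto intro: finite_subset)
  have "card (R' - R) = card (R - R')"
    using fin Suc.prems(3) card_le_sym_Diff[of R R'] card_le_sym_Diff[of R' R] by simp
  with Suc.hyps(2) have "R - R' \<noteq> {}" "R' - R \<noteq> {}"
    by (metis card.empty nat.distinct(1))+
  then obtain x y where x: "x \<in> R" "x \<notin> R'" and y: "y \<in> R'" "y \<notin> R"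
    by auto
  define R1 where "R1 = insert y (R - {x})"
  \<comment> \<open>This covers the set with one free token removed as well as the set after the
    exchange.\<close>
  have size: "card (A - free G \<union> Q) \<le> k" if "card Q \<le> card R" "Q \<subseteq> free G" for Q
  proof -
    have "card (A - free G \<union> Q) \<le> card (A - free G) + card Q"
      by (rule card_Un_le)
    also have "\<dots> \<le> card (A - free G) + card (A \<inter> free G)"
      using that(1) Suc.prems(4) by simp
    also have "\<dots> = card A"
      using fin(3) card_Diff_subset_Int[of A "free G"] card_mono[of A "A \<inter> free G"] by simp
    finally show ?thesis
      using A(1) by simp
  qed
  have sub: "R1 \<subseteq> free G \<inter> U" "R - {x} \<subseteq> free G \<inter> U"
    using Suc.prems y x by (auto simp: R1_def)
  have card1: "card R1 = card R"
    using card_Suc_Diff1[OF fin(1) x(1)] fin(1) y(2) by (simp add: R1_def)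
  have "good (A - free G \<union> (R - {x}))"
    using sub A(1) by (auto intro!: powerful_alliance_change_free size card_mono fin)
  moreover have "good (A - free G \<union> R1)"
    using sub A(1) by (auto intro!: powerful_alliance_change_free size simp: card1)
  moreover have "insert x (A - free G \<union> (R - {x})) = A - free G \<union> R"
    "insert y (A - free G \<union> (R - {x})) = A - free G \<union> R1"
    using x by (auto simp: R1_def)
  moreover have "A - free G \<union> R1 \<subseteq> U"
    using sub A(2) by auto
  moreover have "x \<notin> A - free G \<union> (R - {x})" "y \<notin> A - free G \<union> (R - {x})" "x \<noteq> y"
    using x y Suc.prems by auto
  ultimately have "walk_U (A - free G \<union> R) (A - free G \<union> R1)"
    using exchange[OF Y, of "A - free G \<union> (R - {x})" x y] fin by simp
  moreover have "walk_U (A - free G \<union> R1) (A - free G \<union> R')"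
  proof (rule Suc.hyps(1))
    have "R1 - R' = (R - R') - {x}"
      using y by (auto simp: R1_def)
    then show "d = card (R1 - R')"
      using Suc.hyps(2) x by simp
  qed (use Suc.prems sub card1 in auto)
  ultimately show ?case
    by auto
qed

text \<open>The confined walk goes from \<open>S\<close> to its standard position, along the images
  of the given walk, and from the standard position of \<open>T\<close> to \<open>T\<close>. The
  images lie in \<open>U\<close>: their free tokens sit on elements of \<open>fs\<close>, their
  other tokens by \<open>walk_non_free\<close>.\<close>

lemma walk_confined_TJ_TAR:
  assumes Y: "Y \<noteq> TS" and walk: "walk S T" and sub: "S \<subseteq> U" "T \<subseteq> U"
  shows "walk_U S T"
proof -
  obtain fs where fs: "distinct fs" "set fs = free G \<inter> U"
    using finite_distinct_list[of "free G \<inter> U"] finite_free by auto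
  have fsF: "set fs \<subseteq> free G"
    using fs by auto
  define \<phi> where "\<phi> = normalise fs (free G)"
  have enough: "card (A \<inter> free G) \<le> length fs" if "good A" for A
  proof -
    have "card (A \<inter> free G) \<le> card A" "card (A \<inter> free G) \<le> card (free G)"
      using that finite_free powerful_alliance_finite by (auto intro!: card_mono)
    then have "card (A \<inter> free G) \<le> min k (card (free G))"
      using that by simp
    also have "\<dots> \<le> length fs"
      using U(2) fs distinct_card by fastforce
    finally show ?thesis .
  qed
  have take: "set (take i fs) \<subseteq> free G \<inter> U" for i
    using fs(2) set_take_subset by fast
  have good: "good (\<phi> A)" if "good A" for A
    using that take powerful_alliance_change_free[of A] powerful_alliance_finite[of A]
      card_normalise[OF fs(1) fsF _ enough[OF that]]
    by (auto simp: \<phi>_def normalise_def)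
  have tail: "walk_U A (\<phi> A)" "walk_U (\<phi> A) A" if "good A" "A \<subseteq> U" for A
  proof -
    have split: "A - free G \<union> A \<inter> free G = A"
      by auto
    have c: "card (set (take (card (A \<inter> free G)) fs)) = card (A \<inter> free G)"
      using enough[OF that(1)] fs(1) by (simp add: distinct_card)
    have A: "A - free G \<subseteq> U" "A \<inter> free G \<subseteq> free G \<inter> U"
      using that(2) by auto
    show "walk_U A (\<phi> A)"
      using rearrange[OF Y that(1) A(1) A(2) take c[symmetric] refl]
      by (simp add: split \<phi>_def normalise_def)
    show "walk_U (\<phi> A) A"
      using rearrange[OF Y that(1) A(1) take A(2) c c]
      by (simp add: split \<phi>_def normalise_def)
  qed
  have "walk_U (\<phi> S) (\<phi> T)"
    using walk
  proof induction
    case (step B C)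
    have "walk S C"
      using step.hyps by (rule rtranclp.rtrancl_into_rtrancl)
    then have BC: "good B" "good C" "C - free G \<subseteq> U"
      using walk_good walk_non_free step.hyps(1) by blast+
    have "\<phi> B = \<phi> C \<or> reconf_step Y G (\<phi> B) (\<phi> C)"
      unfolding \<phi>_def using BC powerful_alliance_finite enough Y step.hyps(2)
      by (intro normalise_step[OF fs(1) fsF]) (auto simp: confined_step_def)
    moreover have "\<phi> C \<subseteq> U"
      using BC(3) take by (auto simp: \<phi>_def normalise_def)
    ultimately have "\<phi> B = \<phi> C \<or> confined_step powerful_alliance Y G k U (\<phi> B) (\<phi> C)"
      using good[OF BC(2)] by (auto simp: confined_step_def)
    then show ?case
      using step.IH by auto
  qed simp
  then show ?thesis
    using tail(1)[of S] tail(2)[of T] walk_good[OF walk] S sub by (meson rtranclp_trans)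
qed

lemma walk_confined:
  assumes "walk S T" "T \<subseteq> U"
  shows "walk_U S T"
proof (cases "Y = TS")
  case True
  then show ?thesis
    using walk_TS assms by blast
next
  case False
  have "S \<subseteq> U"
    using U(1) subset_closed_nbhd[of S G] subset_closed_nbhd[of "closed_nbhd G S" G] by blast
  then show ?thesis
    using walk_confined_TJ_TAR False assms by blast
qed

text \<open>A dominating source has the whole vertex set as its closed neighbourhood, so every walk
  is already confined and no tokens need to be rearranged.\<close>

lemma walk_confined_global:
  assumes S: "global_powerful_alliance G S"
    and walk: "(confined_step global_powerful_alliance Y G k UNIV)\<^sup>*\<^sup>* S T"
  shows "(confined_step global_powerful_alliance Y G k U)\<^sup>*\<^sup>* S T"
proof -
  have "pverts G \<subseteq> U"
    using S U(1) subset_closed_nbhd[of "closed_nbhd G S" G]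
    by (auto simp: global_powerful_alliance_def dominating_set_def)
  then have "confined_step global_powerful_alliance Y G k UNIV \<le> confined_step
      global_powerful_alliance Y G k U"
    unfolding confined_step_def global_powerful_alliance_def powerful_alliance_def by blast
  then show ?thesis
    using walk rtranclp_mono by blast
qed

end

section \<open>Correctness of the program\<close>

definition supp :: "bool list \<Rightarrow> nat set" where
  "supp xs = {i. i < length xs \<and> xs ! i}"

lemma supp_simps:
  "supp [] = {}"
  "supp (x # xs) = (if x then insert 0 (Suc ` supp xs) else Suc ` supp xs)"
proof -
  show "supp (x # xs) = (if x then insert 0 (Suc ` supp xs) else Suc ` supp xs)"
  proof (rule set_eqI)
    fix i
    show "i \<in> supp (x # xs) \<longleftrightarrow> i \<in> (if x then insert 0 (Suc ` supp xs) else Suc ` supp xs)"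
      by (cases i) (auto simp: supp_def)
  qed
qed (simp add: supp_def)

lemma Suc_image_subset_iff:
  "Suc ` A \<subseteq> Suc ` B \<longleftrightarrow> A \<subseteq> B"
  "Suc ` A \<subseteq> insert 0 (Suc ` B) \<longleftrightarrow> A \<subseteq> B"
  "insert 0 (Suc ` A) \<subseteq> insert 0 (Suc ` B) \<longleftrightarrow> A \<subseteq> B"
  "\<not> insert 0 (Suc ` A) \<subseteq> Suc ` B"
  by (auto simp: subset_iff image_iff)

lemma finite_supp [simp]: "finite (supp xs)"
  by (simp add: supp_def)

lemma supp_subset: "supp xs \<subseteq> {..<length xs}"
  by (auto simp: supp_def)

lemma supp_inject:
  assumes "length xs = length ys"
  shows "supp xs = supp ys \<longleftrightarrow> xs = ys"
proof
  assume eq: "supp xs = supp ys"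
  show "xs = ys"
  proof (rule nth_equalityI)
    fix i
    assume "i < length xs"
    moreover have "i \<in> supp xs \<longleftrightarrow> i \<in> supp ys"
      using eq by simp
    ultimately show "xs ! i = ys ! i"
      using assms by (simp add: supp_def)
  qed (rule assms)
qed simp

definition vec :: "nat \<Rightarrow> nat set \<Rightarrow> bool list" where
  "vec n A = map (\<lambda>v. v \<in> A) [0..<n]"

lemma length_vec [simp]: "length (vec n A) = n"
  by (simp add: vec_def)

lemma supp_vec: "A \<subseteq> {..<n} \<Longrightarrow> supp (vec n A) = A"
  by (auto simp: supp_def vec_def)

lemma vec_supp: "vec (length xs) (supp xs) = xs"
  by (rule nth_equalityI) (simp_all add: vec_def supp_def)

lemma cnt_eq_card: "length xs = length ys \<Longrightarrow> cnt xs ys = card (supp xs \<inter> supp ys)"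
proof (induction xs ys rule: list_induct2)
  case (Cons x xs y ys)
  have "card (Suc ` supp xs \<inter> Suc ` supp ys) = card (supp xs \<inter> supp ys)"
    by (simp flip: image_Int add: card_image)
  moreover have "card (insert 0 (Suc ` supp xs \<inter> Suc ` supp ys)) = Suc (card
      (Suc ` supp xs \<inter> Suc ` supp ys))"
    by (rule card_insert_disjoint) auto
  ultimately show ?case
    using Cons.IH by (auto simp: supp_simps)
qed (simp add: supp_simps)

lemma supp_dif: "length xs = length ys \<Longrightarrow> supp (dif xs ys) = supp xs - supp ys"
  by (auto simp: supp_def dif_def)

lemma cntd_eq_card: "length xs = length ys \<Longrightarrow> cntd xs ys = card (supp xs - supp ys)"
  by (simp add: cntd_def cnt_eq_card supp_dif)

lemma supp_join: "length xs = length ys \<Longrightarrow> supp (join xs ys) = supp xs \<union> supp ys"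
  by (auto simp: supp_def join_def)

lemma supp_trunc:
  "supp (trunc k xs) \<subseteq> {..<length xs} - supp xs"
  "card (supp (trunc k xs)) = min k (card ({..<length xs} - supp xs))"
proof (induction k xs rule: trunc.induct)
  case (2 k x xs)
  have eq: "{..<length (x # xs)} - supp (x # xs) =
    (if x then Suc ` ({..<length xs} - supp xs) else insert 0 (Suc ` ({..<length xs} - supp xs)))"
    by (auto simp: supp_simps lessThan_Suc_eq_insert_0 split: if_splits)
  {
    case 1
    show ?case
      unfolding eq using "2.IH"(1) "2.IH"(3)
      by (cases x) (auto simp: supp_simps Suc_image_subset_iff simp del: lessThan_iff)
  next
    case 2
    have "card (insert 0 (Suc ` B)) = Suc (card B)" if "finite B" for B
      using that by (subst card_insert_disjoint) (auto simp: card_image)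
    then show ?case
      unfolding eq using "2.IH"(2) "2.IH"(4) by (auto simp: supp_simps card_image split: if_splits)
  }
qed (auto simp: supp_simps)

lemma subvectors_iff: "A \<in> set (subvectors us) \<longleftrightarrow> length A = length us \<and> supp A \<subseteq> supp us"
proof (induction us arbitrary: A)
  case (Cons u us)
  show ?case
  proof (cases A)
    case (Cons a A')
    have "a # A' \<in> (#) c ` X \<longleftrightarrow> a = c \<and> A' \<in> X" for c X
      by auto
    then show ?thesis
      using Cons by (cases a; cases u) (simp_all add: branch_def Cons.IH supp_simps
          Suc_image_subset_iff)
  qed (auto simp: branch_def)
qed (auto simp: supp_simps)

section \<open>Matrices as graphs\<close>

definition graph_of :: "bool list list \<Rightarrow> nat pair_pre_digraph" where
  "graph_of M = \<lparr>pverts = {..<length M}, parcs = {(u, v). u < length M \<and> v < length M \<and> M ! u ! v}\<rparr>"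

lemma pverts_graph_of [simp]: "pverts (graph_of M) = {..<length M}"
  by (simp add: graph_of_def)

lemma neighbours_graph_of:
  "square n M \<Longrightarrow> v < n \<Longrightarrow> neighbours (graph_of M) v = supp (M ! v)"
  by (auto simp: neighbours_def graph_of_def supp_def square_def)

text \<open>Splitting index zero off each quantifier separates the first row and column from the
  minor, to which the induction hypothesis applies.\<close>

lemma symm_iff:
  "square n M \<Longrightarrow> symm M \<longleftrightarrow>
     (\<forall>i<n. \<not> M ! i ! i) \<and> (\<forall>i<n. \<forall>j<n. M ! i ! j \<longleftrightarrow> M ! j ! i)"
proof (induction M arbitrary: n rule: symm.induct)
  case 1
  then show ?case
    by (simp add: square_def)
next
  case (2 r M)
  from square_Cons[OF "2.prems"] obtain m b r' where m: "n = Suc m" "r = b # r'" "length r' = m"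
    "length M = m" "[] \<notin> set M" "square m (map tl M)" .
  have IH: "symm (map tl M) \<longleftrightarrow>
    (\<forall>i<m. \<not> map tl M ! i ! i) \<and> (\<forall>i<m. \<forall>j<m. map tl M ! i ! j \<longleftrightarrow> map tl M ! j ! i)"
    using "2.IH" m(6) by blast
  have hd: "hd (M ! i) = M ! i ! 0" "tl (M ! i) ! j = M ! i ! Suc j" if "i < m" "j < m" for i j
  proof -
    have "M ! i \<noteq> []"
      using that m(4,5) by (metis nth_mem)
    moreover have "j < length (tl (M ! i))"
      using that m(4,6) by (simp add: square_def)
    ultimately show "hd (M ! i) = M ! i ! 0" "tl (M ! i) ! j = M ! i ! Suc j"
      by (simp_all add: hd_conv_nth nth_tl)
  qed
  have "r' = map hd M \<longleftrightarrow> (\<forall>i<m. r' ! i = M ! i ! 0)"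
    using m(3,4) hd(1) by (auto simp: list_eq_iff_nth_eq)
  then have lhs: "symm (r # M) \<longleftrightarrow> \<not> b \<and> (\<forall>i<m. r' ! i = M ! i ! 0) \<and>
    (\<forall>i<m. \<not> M ! i ! Suc i) \<and> (\<forall>i<m. \<forall>j<m. M ! i ! Suc j = M ! j ! Suc i)"
    using IH hd(2) m(2,4) by simp
  have diag: "(\<forall>i<n. \<not> (r # M) ! i ! i) \<longleftrightarrow> \<not> b \<and> (\<forall>i<m. \<not> M ! i ! Suc i)"
    by (simp add: m(1,2) All_less_Suc2)
  have off: "(\<forall>i<n. \<forall>j<n. (r # M) ! i ! j = (r # M) ! j ! i) \<longleftrightarrow>
    (\<forall>i<m. r' ! i = M ! i ! 0) \<and> (\<forall>i<m. M ! i ! 0 = r' ! i \<and> (\<forall>j<m. M ! i ! Suc j = M ! j ! Suc i))"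
    by (simp add: m(1,2) All_less_Suc2)
  show ?case
    unfolding lhs diag off by blast
qed

lemma pair_graph_graph_of:
  assumes "square n M"
  shows "pair_graph (graph_of M) \<longleftrightarrow> symm M"
proof
  assume "pair_graph (graph_of M)"
  then interpret pair_graph "graph_of M" .
  show "symm M"
    unfolding symm_iff[OF assms]
    using neighbours_irrefl neighbours_sym assms
    by (auto simp: neighbours_def graph_of_def square_def)
next
  assume "symm M"
  then have s: "(\<forall>i<n. \<not> M ! i ! i) \<and> (\<forall>i<n. \<forall>j<n. M ! i ! j \<longleftrightarrow> M ! j ! i)"
    using symm_iff[OF assms] by simp
  have "finite {(u, v). u < length M \<and> v < length M \<and> M ! u ! v}"
    by (rule finite_subset[of _ "{..<length M} \<times> {..<length M}"]) auto
  then show "pair_graph (graph_of M)"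
    using s assms by unfold_locales
      (auto simp: graph_of_def square_def symmetric_def sym_def)
qed

definition alliance_property :: "bool \<Rightarrow> nat pair_pre_digraph \<Rightarrow> nat set \<Rightarrow> bool" where
  "alliance_property g = (if g then global_powerful_alliance else powerful_alliance)"

lemma alliance_property_PA: "alliance_property g G A \<Longrightarrow> powerful_alliance G A"
  by (auto simp: alliance_property_def global_powerful_alliance_def split: if_splits)

lemma pa_rows_iff:
  "length M = length B \<Longrightarrow> pa_rows g M B A \<longleftrightarrow>
    (\<forall>i<length M. if B ! i then cntd (M ! i) A \<le> Suc (cnt (M ! i) A)
      else if cnt (M ! i) A = 0 then \<not> g else Suc (cntd (M ! i) A) \<le> cnt (M ! i) A)"
  by (induction M B rule: list_induct2) (auto simp: All_less_Suc2)

lemma adj_iff: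
  "length M = length xs \<Longrightarrow> adj M xs ys \<longleftrightarrow> (\<exists>i<length M. xs ! i \<and> cnt (M ! i) ys \<noteq> 0)"
  by (induction M xs rule: list_induct2) (auto simp: Ex_less_Suc2)

section \<open>Correctness of the tests and of the search\<close>

locale adjacency_matrix =
  fixes n :: nat and M :: "bool list list"
  assumes square: "square n M" and symm: "symm M"
begin

abbreviation G :: "nat pair_pre_digraph" where
  "G \<equiv> graph_of M"

sublocale pair_graph G
  using pair_graph_graph_of square symm by simp

lemma length_M [simp]: "length M = n"
  using square by (simp add: square_def)

lemma length_row: "v < n \<Longrightarrow> length (M ! v) = n"
  using square by (simp add: square_def)

lemma cnt_row:
  assumes "length A = n" "v < n"
  shows "cnt (M ! v) A = deg_in G (supp A) v" "cntd (M ! v) A = deg_in G (pverts G - supp A) v"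
proof -
  show "cnt (M ! v) A = deg_in G (supp A) v"
    using assms length_row neighbours_graph_of[OF square] by (simp add: deg_in_def cnt_eq_card)
  have "supp (M ! v) - supp A = supp (M ! v) \<inter> ({..<n} - supp A)"
    using supp_subset[of "M ! v"] length_row[OF assms(2)] by auto
  then show "cntd (M ! v) A = deg_in G (pverts G - supp A) v"
    using assms length_row neighbours_graph_of[OF square] by (simp add: deg_in_def cntd_eq_card)
qed

lemma deg_in_0: "deg_in G A v = 0 \<longleftrightarrow> neighbours G v \<inter> A = {}"
  by (simp add: deg_in_def)

lemma ok_iff:
  assumes A: "length A = n"
  shows "ok g M k A \<longleftrightarrow> alliance_property g G (supp A) \<and> card (supp A) \<le> k"
proof -
  have sub: "supp A \<subseteq> {..<n}"
    using supp_subset A by auto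
  have rows: "pa_rows g M A A \<longleftrightarrow>
    (\<forall>i<n. if i \<in> supp A then deg_in G (pverts G - supp A) i \<le> deg_in G (supp A) i + 1
      else if i \<notin> closed_nbhd G (supp A) then \<not> g
      else deg_in G (pverts G - supp A) i + 1 \<le> deg_in G (supp A) i)"
    using A cnt_row[OF A] unfolding closed_nbhd_iff
    by (auto simp: pa_rows_iff supp_def deg_in_0 split: if_splits)
  have bnd: "boundary G (supp A) \<subseteq> {..<n}"
    using closed_nbhd_subset[of "supp A"] sub by (auto simp: boundary_def)
  have "pa_rows g M A A \<longleftrightarrow> powerful_alliance G (supp A) \<and> (g \<longrightarrow> {..<n} \<subseteq> closed_nbhd G (supp A))"
    unfolding rows powerful_alliance_def boundary_def
    using sub bnd closed_nbhd_subset[of "supp A"] subset_closed_nbhd[of "supp A" G]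
    by (auto simp: boundary_def split: if_splits)
  moreover have "{..<n} \<subseteq> closed_nbhd G (supp A) \<longleftrightarrow> dominating_set G (supp A)"
    using sub closed_nbhd_subset[of "supp A"] by (auto simp: dominating_set_def)
  ultimately show ?thesis
    using A by (auto simp: ok_def alliance_property_def global_powerful_alliance_def cnt_eq_card)
qed

lemma supp_nbh:
  assumes "length A = n"
  shows "supp (nbh M A A) = closed_nbhd G (supp A)"
proof -
  have "closed_nbhd G (supp A) \<subseteq> {..<n}"
    using closed_nbhd_subset[of "supp A"] supp_subset[of A] assms by auto
  moreover have "i \<in> supp (nbh M A A) \<longleftrightarrow> i \<in> closed_nbhd G (supp A)" if "i < n" for i
  proof -
    have "i \<in> supp (nbh M A A) \<longleftrightarrow> A ! i \<or> cnt (M ! i) A \<noteq> 0" "i \<in> supp A \<longleftrightarrow> A ! i"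
      using that assms by (simp_all add: supp_def nbh_def)
    then show ?thesis
      unfolding closed_nbhd_iff cnt_row(1)[OF assms that] deg_in_0 by simp
  qed
  ultimately show ?thesis
    using supp_subset[of "nbh M A A"] assms by auto
qed

lemma supp_high: "supp (high M) = {v \<in> pverts G. 2 \<le> degree G v}"
proof (rule set_eqI)
  fix v
  have "v \<in> supp (high M) \<longleftrightarrow> v < n \<and> 2 \<le> cnt (M ! v) (M ! v)"
    by (auto simp: supp_def high_def)
  also have "\<dots> \<longleftrightarrow> v \<in> {v \<in> pverts G. 2 \<le> degree G v}"
    by (auto simp: cnt_eq_card degree_def neighbours_graph_of[OF square])
  finally show "v \<in> supp (high M) \<longleftrightarrow> v \<in> {v \<in> pverts G. 2 \<le> degree G v}" .
qed

lemma free_eq: "free G = {..<n} - supp (nbh M (high M) (high M))"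
  by (simp add: free_def supp_nbh supp_high)

lemma step_iff:
  assumes A: "length A = n" and B: "length B = n"
  shows "step Y M A B \<longleftrightarrow> reconf_step Y G (supp A) (supp B)"
proof -
  have c: "cntd A B = card (supp A - supp B)" "cntd B A = card (supp B - supp A)"
    using A B by (simp_all add: cntd_eq_card)
  have split: "card X = card (X \<inter> Z) + card (X - Z)" if "finite X" for X Z :: "nat set"
    using card_Un_disjoint[of "X \<inter> Z" "X - Z"] that by (simp add: Int_Diff_Un Int_Diff_disjoint)
  \<comment> \<open>Both cardinalities contain that of the intersection, which cancels.\<close>
  have "card (supp A) = card (supp B) \<longleftrightarrow> card (supp A - supp B) = card (supp B - supp A)"
    using split[of "supp A" "supp B"] split[of "supp B" "supp A"] by (simp add: Int_commute)
  then have tj: "tj_step (supp A) (supp B) \<longleftrightarrow> cntd A B = 1 \<and> cntd B A = 1"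
    unfolding c tj_step_def by auto
  show ?thesis
  proof (cases Y)
    case TJ
    then show ?thesis
      using tj by (simp add: step_def)
  next
    case TS
    have "adj M (dif A B) (dif B A) \<longleftrightarrow>
      (\<exists>i\<in>supp A - supp B. neighbours G i \<inter> (supp B - supp A) \<noteq> {})"
    proof -
      have mem: "i < n \<and> dif A B ! i \<longleftrightarrow> i \<in> supp A - supp B" for i
        using A B supp_dif[of A B] by (auto simp: supp_def)
      have pos: "cnt (M ! i) (dif B A) \<noteq> 0 \<longleftrightarrow> neighbours G i \<inter> (supp B - supp A) \<noteq> {}" if
          "i < n" for i
        using cnt_row(1)[of "dif B A" i] A B that deg_in_0 supp_dif[of B A] by simp
      have "length M = length (dif A B)"
        using A B by simp
      from adj_iff[OF this] show ?thesis
        unfolding length_M using mem pos by metis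
    qed
    moreover have "ts_step G (supp A) (supp B) \<longleftrightarrow> tj_step (supp A) (supp B) \<and>
      (\<exists>i\<in>supp A - supp B. neighbours G i \<inter> (supp B - supp A) \<noteq> {})"
    proof (cases "tj_step (supp A) (supp B)")
      case True
      then obtain u v where "supp A - supp B = {u}" "supp B - supp A = {v}"
        unfolding tj c by (auto simp: card_1_singleton_iff)
      then show ?thesis
        using True by (auto simp: ts_step_def neighbours_def)
    qed (simp add: ts_step_def)
    ultimately show ?thesis
      using TS tj by (simp add: step_def)
  next
    case TAR
    have "(\<exists>v. v \<notin> X \<and> Z = insert v X) \<longleftrightarrow> card (X - Z) = 0 \<and> card (Z - X) = 1"
      if "finite X" "finite Z" for X Z :: "nat set"
    proof
      assume diff: "card (X - Z) = 0 \<and> card (Z - X) = 1"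
      then have "X - Z = {}"
        using that by (metis card_0_eq finite_Diff)
      moreover from diff obtain v where "Z - X = {v}"
        by (auto simp: card_1_singleton_iff)
      ultimately have "v \<notin> X \<and> Z = insert v X"
        by blast
      then show "\<exists>v. v \<notin> X \<and> Z = insert v X" ..
    next
      assume "\<exists>v. v \<notin> X \<and> Z = insert v X"
      then obtain v where "v \<notin> X" "Z = insert v X"
        by blast
      then have "X - Z = {}" "Z - X = {v}"
        by auto
      then show "card (X - Z) = 0 \<and> card (Z - X) = 1"
        by (simp only: card.empty) simp
    qed
    then have "tar_step (supp A) (supp B) \<longleftrightarrow> card (supp A - supp B) = 0 \<and> card
        (supp B - supp A) = 1 \<or>
      card (supp B - supp A) = 0 \<and> card (supp A - supp B) = 1"
      unfolding tar_step_def by simp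
    then show ?thesis
      using TAR c by (auto simp: step_def)
  qed
qed

lemma reach_iff:
  assumes C: "\<forall>B\<in>set C. length B = n" and A: "length A = n" and T: "length T = n"
  shows "reach Y M T C (length C) A \<longleftrightarrow>
    (\<lambda>B B'. reconf_step Y G B B' \<and> B' \<in> supp ` set C)\<^sup>*\<^sup>* (supp A) (supp T)"
    (is "_ \<longleftrightarrow> ?R\<^sup>*\<^sup>* _ _")
proof
  have "?R\<^sup>*\<^sup>* (supp A) (supp T)" if "reach Y M T C j A" "length A = n" for j A
    using that
  proof (induction j arbitrary: A)
    case (Suc j)
    show ?case
    proof (cases "A = T")
      case False
      then obtain B where B: "B \<in> set C" "step Y M A B" "reach Y M T C j B"
        using Suc.prems by auto
      then have "?R (supp A) (supp B)"
        using step_iff[OF Suc.prems(2), of B] C by auto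
      moreover have "?R\<^sup>*\<^sup>* (supp B) (supp T)"
        using Suc.IH B C by auto
      ultimately show ?thesis
        by (rule converse_rtranclp_into_rtranclp)
    qed simp
  qed simp
  then show "reach Y M T C (length C) A \<Longrightarrow> ?R\<^sup>*\<^sup>* (supp A) (supp T)"
    using A by blast
next
  have mono1: "reach Y M T C (Suc j) A" if "reach Y M T C j A" for j A
    using that by (induction j arbitrary: A) auto
  have mono: "reach Y M T C j A" if "reach Y M T C i A" "i \<le> j" for i j A
    using that(2)
  proof (induction rule: dec_induct)
    case (step j)
    then show ?case
      using mono1 by blast
  qed (rule that(1))
  have path: "reach Y M T C (length Bs) A" if "rtrancl_path ?R (supp A) Bs (supp T)"
      "length A = n" for Bs A
    using that
  proof (induction "supp A" Bs "supp T" arbitrary: A rule: rtrancl_path.induct)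
    case base
    then show ?case
      using supp_inject[of A T] T by simp
  next
    case (step B Bs)
    then obtain B' where B': "B' \<in> set C" "B = supp B'"
      by auto
    then have "reach Y M T C (length Bs) B'"
      using step C by auto
    moreover have "step Y M A B'"
      using step_iff[OF step.prems, of B'] step.hyps(1) B' C by auto
    ultimately show ?case
      using B'(1) by auto
  qed
  assume "?R\<^sup>*\<^sup>* (supp A) (supp T)"
  then obtain Bs0 where "rtrancl_path ?R (supp A) Bs0 (supp T)"
    unfolding rtranclp_eq_rtrancl_path by blast
  \<comment> \<open>A walk without repetitions, all of whose sets after the start come from
    \<open>C\<close>, has at most \<open>length C\<close> steps; surplus fuel does no harm by
    \<open>mono\<close>.\<close>
  then obtain Bs where Bs: "rtrancl_path ?R (supp A) Bs (supp T)" "distinct (supp A # Bs)"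
    by (rule rtrancl_path_distinct)
  have "set Bs \<subseteq> supp ` set C"
    using Bs(1) by (induction rule: rtrancl_path.induct) auto
  then have "card (set Bs) \<le> card (supp ` set C)"
    by (intro card_mono) auto
  also have "\<dots> \<le> length C"
    using card_image_le[of "set C" supp] card_length[of C] by simp
  finally have "length Bs \<le> length C"
    using Bs(2) by (simp add: distinct_card)
  then show "reach Y M T C (length C) A"
    using mono[OF path[OF Bs(1) A]] by simp
qed

lemma length_region: "length S = n \<Longrightarrow> length T = n \<Longrightarrow> length (region M k S T) = n"
  by (simp add: region_def)

lemma supp_region:
  assumes "length S = n" "length T = n"
  shows "supp (region M k S T) = supp T \<union> supp (trunc k (nbh M (high M) (high M))) \<union>
    closed_nbhd G (closed_nbhd G (supp S))"
  using assms by (simp add: region_def supp_join supp_nbh Un_assoc)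

text \<open>The candidates are exactly the admissible subsets of the region, so the search decides
  the existence of a confined walk. That an arbitrary walk can be confined is the combinatorial
  part; the converse is monotonicity.\<close>

lemma solve_iff:
  assumes S: "length S = n" "ok g M k S" and T: "length T = n" "ok g M k T"
  shows "solve g Y k M S T \<longleftrightarrow>
    (confined_step (alliance_property g) Y G k UNIV)\<^sup>*\<^sup>* (supp S) (supp T)"
proof -
  let ?U = "supp (region M k S T)"
  have len: "length (region M k S T) = n"
    using S(1) T(1) by (rule length_region)
  have C: "\<forall>B\<in>set (candidates g M k S T). length B = n"
    using len by (auto simp: candidates_def subvectors_iff)
  have sub: "?U \<subseteq> {..<n}"
    using supp_subset len by metis
  have "B \<in> supp ` set (candidates g M k S T) \<longleftrightarrow> alliance_property g G B \<and> card B \<le> k \<and> B \<subseteq> ?U" for B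
  proof
    assume "alliance_property g G B \<and> card B \<le> k \<and> B \<subseteq> ?U"
    moreover from this have "supp (vec n B) = B"
      using sub by (intro supp_vec) auto
    ultimately have "vec n B \<in> set (candidates g M k S T)"
      using len ok_iff[of "vec n B" g k] by (simp add: candidates_def subvectors_iff)
    then show "B \<in> supp ` set (candidates g M k S T)"
      using \<open>supp (vec n B) = B\<close> by (metis imageI)
  qed (use len ok_iff in \<open>auto simp: candidates_def subvectors_iff\<close>)
  then have "solve g Y k M S T \<longleftrightarrow>
      (confined_step (alliance_property g) Y G k ?U)\<^sup>*\<^sup>* (supp S) (supp T)"
    unfolding solve_def Let_def reach_iff[OF C S(1) T(1)] confined_step_def by simp
  also have "\<dots> \<longleftrightarrow> (confined_step (alliance_property g) Y G k UNIV)\<^sup>*\<^sup>* (supp S) (supp T)"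
  proof
    assume walk: "(confined_step (alliance_property g) Y G k UNIV)\<^sup>*\<^sup>* (supp S) (supp T)"
    have PA: "alliance_property g G (supp S)" "card (supp S) \<le> k"
      using ok_iff[OF S(1)] S(2) by auto
    have T_sub: "supp T \<subseteq> ?U"
      unfolding supp_region[OF S(1) T(1)] by blast
    \<comment> \<open>The vertices selected by \<open>trunc\<close> witness that the region has room
      for enough free tokens.\<close>
    have "free G \<inter> ?U \<supseteq> supp (trunc k (nbh M (high M) (high M)))"
      using supp_trunc(1)[of k "nbh M (high M) (high M)"] S(1) T(1) by
          (auto simp: free_eq supp_region)
    then have "card (supp (trunc k (nbh M (high M) (high M)))) \<le> card (free G \<inter> ?U)"
      by (intro card_mono) auto
    then have "min k (card (free G)) \<le> card (free G \<inter> ?U)"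
      by (simp add: supp_trunc(2) free_eq)
    then interpret br: bounded_reconf G Y k ?U "supp S"
      using PA S(1) T(1) by unfold_locales (auto simp: supp_region dest: alliance_property_PA)
    show "(confined_step (alliance_property g) Y G k ?U)\<^sup>*\<^sup>* (supp S) (supp T)"
      using walk PA(1) T_sub br.walk_confined br.walk_confined_global
      by (cases g) (auto simp: alliance_property_def)
  qed (rule confined_step_mono, simp)
  finally show ?thesis .
qed

text \<open>In the exponent, \<open>2 * k\<close> accounts for the target and for the selected free
  vertices, the rest for the second neighbourhood of the source.\<close>

lemma length_subvectors_region_le:
  assumes S: "length S = n" "ok g M k S" and T: "length T = n" "ok g M k T"
  shows "length (subvectors (region M k S T)) \<le> 2 ^ (2 * k + k * (2 * k + 2) * (2 * k + 2))"
proof -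
  have PA: "powerful_alliance G (supp S)" "card (supp S) \<le> k" "card (supp T) \<le> k"
    using ok_iff[OF S(1)] ok_iff[OF T(1)] S(2) T(2) by (auto dest: alliance_property_PA)
  have "card (supp (region M k S T)) \<le>
      card (supp T) + card (supp (trunc k (nbh M (high M) (high M)))) +
      card (closed_nbhd G (closed_nbhd G (supp S)))"
    unfolding supp_region[OF S(1) T(1)] using card_Un_le by
        (intro order_trans[OF card_Un_le] add_mono) auto
  also have "\<dots> \<le> k + k + k * (2 * k + 2) * (2 * k + 2)"
    using PA(3) card_second_nbhd_le[OF PA(1,2)]
    by (intro add_mono) (simp_all add: supp_trunc(2))
  finally have "cnt (region M k S T) (region M k S T) \<le> 2 * k + k * (2 * k + 2) * (2 * k + 2)"
    by (simp add: cnt_eq_card mult_2)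
  then show ?thesis
    unfolding length_subvectors by (intro power_increasing) auto
qed

end

section \<open>From walks to sequences, and from words to instances\<close>

lemma card_reconf_step: "reconf_step Y G A B \<Longrightarrow> Y \<noteq> TAR \<Longrightarrow> card B = card A"
  by (cases Y) (auto simp: ts_step_def tj_step_def)

text \<open>\<open>confined_step\<close> imposes the size bound under every rule. Jumping and
  sliding preserve cardinality, so for them the bound is inherited from \<open>S\<close>.\<close>

lemma reconfigurable_iff:
  assumes "X G S" "card S \<le> k"
  shows "reconfigurable X Y G k S T \<longleftrightarrow> (confined_step X Y G k UNIV)\<^sup>*\<^sup>* S T"
    (is "_ \<longleftrightarrow> ?R\<^sup>*\<^sup>* _ _")
proof
  have "?R\<^sup>*\<^sup>* (hd As) (last As)"
    if "As \<noteq> []" "successively (reconf_step Y G) As" "card (hd As) \<le> k"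
      "\<forall>A\<in>set As. X G A \<and> (Y = TAR \<longrightarrow> card A \<le> k)" for As
    using that
  proof (induction As rule: induct_list012)
    case (3 A B As)
    then have "card B \<le> k"
      using card_reconf_step[of Y G A B] by (cases "Y = TAR") auto
    then have "?R A B"
      using 3 by (simp add: confined_step_def)
    moreover have "?R\<^sup>*\<^sup>* (hd (B # As)) (last (B # As))"
      by (rule 3) (use 3 \<open>card B \<le> k\<close> in simp_all)
    ultimately show ?case
      by (auto intro: converse_rtranclp_into_rtranclp)
  qed auto
  then show "reconfigurable X Y G k S T \<Longrightarrow> ?R\<^sup>*\<^sup>* S T"
    using assms(2) unfolding reconfigurable_def by blast
next
  assume "?R\<^sup>*\<^sup>* S T"
  then show "reconfigurable X Y G k S T"
  proof induction
    case base
    have "[S] \<noteq> [] \<and> hd [S] = S \<and> last [S] = S \<and>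
        (\<forall>A\<in>set [S]. X G A \<and> (Y = TAR \<longrightarrow> card A \<le> k)) \<and> successively (reconf_step Y G) [S]"
      using assms by simp
    then show ?case
      unfolding reconfigurable_def by blast
  next
    case (step B C)
    then obtain As where As: "As \<noteq> []" "hd As = S" "last As = B"
      "\<forall>A\<in>set As. X G A \<and> (Y = TAR \<longrightarrow> card A \<le> k)" "successively (reconf_step Y G) As"
      unfolding reconfigurable_def by blast
    then have "As @ [C] \<noteq> [] \<and> hd (As @ [C]) = S \<and> last (As @ [C]) = C \<and>
        (\<forall>A\<in>set (As @ [C]). X G A \<and> (Y = TAR \<longrightarrow> card A \<le> k)) \<and>
        successively (reconf_step Y G) (As @ [C])"
      using step.hyps(2) by (auto simp: successively_append_iff confined_step_def)
    then show ?case
      unfolding reconfigurable_def by blast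
  qed
qed

lemma concat_rows: "concat (rows m n w) = take (m * n) w"
  by (induction m arbitrary: w) (auto simp: take_add)

lemma rows_concat:
  "\<forall>r\<in>set rs. length r = n \<Longrightarrow> rows (length rs) n (concat rs @ w) = rs"
  by (induction rs) auto

lemma length_concat_rows: "\<forall>r\<in>set rs. length r = n \<Longrightarrow> length (concat rs) = length rs * n"
  by (induction rs) auto

definition encode :: "nat \<Rightarrow> bool list list \<Rightarrow> bool list \<Rightarrow> bool list \<Rightarrow> bool list" where
  "encode n M S T = replicate n True @ False # concat M @ S @ T"

lemma decode_encode:
  assumes "square n M" "length S = n" "length T = n"
  defines "w \<equiv> encode n M S T"
  shows "dropWhile id w \<noteq> []" "size_of w = n" "matrix_of w = M" "source_of w = S" "target_of w = T"
proof -
  have tw: "takeWhile id w = replicate n True" "dropWhile id w = False # concat M @ S @ T"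
    unfolding w_def encode_def by (induction n) simp_all
  then show "dropWhile id w \<noteq> []" and n: "size_of w = n"
    by (simp_all add: size_of_def)
  have p: "payload w = concat M @ S @ T"
    using tw by (simp add: payload_def)
  show "matrix_of w = M"
    using rows_concat[of M n "S @ T"] assms(1) unfolding matrix_of_def n p by (simp add: square_def)
  have "length (concat M) = n * n"
    using length_concat_rows[of M n] assms(1) by (simp add: square_def)
  then show "source_of w = S" "target_of w = T"
    unfolding source_of_def target_of_def n p using assms(2) by simp_all
qed

text \<open>Needed for soundness: an accepted word must be literally an instance word, not merely
  decode to some yes-instance.\<close>

lemma encode_decode:
  assumes "dropWhile id w \<noteq> []" "length (target_of w) = size_of w"
  shows "w = encode (size_of w) (matrix_of w) (source_of w) (target_of w)"
proof -
  have "takeWhile id w = replicate (size_of w) True"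
    unfolding size_of_def by (rule replicate_eqI) (auto dest: set_takeWhileD)
  moreover have "dropWhile id w = False # payload w"
    using assms(1) hd_dropWhile[of id w] by (cases "dropWhile id w") (auto simp: payload_def)
  moreover have "payload w = concat (matrix_of w) @ source_of w @ target_of w"
    unfolding matrix_of_def source_of_def target_of_def concat_rows by
        (simp only: append_take_drop_id)
  ultimately show ?thesis
    unfolding encode_def by (metis takeWhile_dropWhile_id)
qed

definition matrix :: "nat pair_pre_digraph \<Rightarrow> nat \<Rightarrow> bool list list" where
  "matrix G n = map (\<lambda>u. map (\<lambda>v. (u, v) \<in> parcs G) [0..<n]) [0..<n]"

lemma square_matrix: "square n (matrix G n)"
  by (auto simp: square_def matrix_def)

lemma instance_word_eq_encode:
  "pverts G = {..<n} \<Longrightarrow> instance_word G S T = encode n (matrix G n) (vec n S) (vec n T)"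
  by (simp add: instance_word_def encode_def matrix_def vec_def)

lemma graph_of_matrix:
  assumes "pair_graph G" "pverts G = {..<n}"
  shows "graph_of (matrix G n) = G"
proof -
  interpret pair_graph G
    by (rule assms(1))
  have "parcs (graph_of (matrix G n)) = parcs G"
    using in_arcsD1 in_arcsD2 assms(2) by (auto simp: graph_of_def matrix_def)
  moreover have "pverts (graph_of (matrix G n)) = pverts G"
    using assms(2) by (simp add: matrix_def)
  ultimately show ?thesis
    by (simp add: graph_of_def)
qed

lemma matrix_graph_of: "square n M \<Longrightarrow> matrix (graph_of M) n = M"
  by (rule nth_equalityI; (rule nth_equalityI)?) (auto simp: matrix_def graph_of_def square_def)

lemma check_iff:
  assumes M: "square n M" "symm M" and S: "length S = n" and T: "length T = n"
  shows "check g Y k n M S T \<longleftrightarrow>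
    alliance_property g (graph_of M) (supp S) \<and> alliance_property g (graph_of M) (supp T) \<and>
    card (supp S) \<le> k \<and> card (supp T) \<le> k \<and>
    (Y \<noteq> TAR \<longrightarrow> card (supp S) = k \<and> card (supp T) = k) \<and>
    reconfigurable (alliance_property g) Y (graph_of M) k (supp S) (supp T)"
proof -
  interpret adjacency_matrix n M
    using M by unfold_locales
  show ?thesis
    using solve_iff[OF S _ T] reconfigurable_iff[of "alliance_property g" G "supp S" k Y "supp T"]
      ok_iff[OF S] ok_iff[OF T] M S T
    by (auto simp: check_def cnt_eq_card)
qed

lemma accepts_iff: "accepts g Y w k \<longleftrightarrow> (w, k) \<in> reconf_problem (alliance_property g) Y"
proof
  assume acc: "accepts g Y w k"
  define n M S T where "n = size_of w" "M = matrix_of w" "S = source_of w" "T = target_of w"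
  note defs = this
  have chk: "check g Y k n M S T" and w: "dropWhile id w \<noteq> []"
    using acc by (simp_all add: accepts_def defs)
  then have T: "length T = n" and sym: "symm M"
    by (simp_all add: check_def)
  then have M: "square n M" and S: "length S = n"
    using square_matrix_of[of w] by (simp_all add: defs)
  have "w = encode n M S T"
    using encode_decode[OF w] T by (simp add: defs)
  also have "\<dots> = instance_word (graph_of M) (supp S) (supp T)"
    using instance_word_eq_encode[of "graph_of M" n] M S T vec_supp[of S] vec_supp[of T]
    by (simp add: matrix_graph_of square_def)
  finally have word: "w = instance_word (graph_of M) (supp S) (supp T)" .
  have graph: "pair_graph (graph_of M)" "pverts (graph_of M) = {..<n}"
    using pair_graph_graph_of[OF M] sym M by (simp_all add: square_def)
  show "(w, k) \<in> reconf_problem (alliance_property g) Y"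
    unfolding reconf_problem_def mem_Collect_eq
    by (intro exI[of _ "graph_of M"] exI[of _ "supp S"] exI[of _ "supp T"] exI[of _ k])
      (use word graph chk[unfolded check_iff[OF M sym S T]] in simp)
next
  assume "(w, k) \<in> reconf_problem (alliance_property g) Y"
  then obtain G S T n where w: "w = instance_word G S T" and G: "pair_graph G" "pverts G = {..<n}"
    and X: "alliance_property g G S" "alliance_property g G T"
    and size: "Y \<noteq> TAR \<longrightarrow> card S = k \<and> card T = k"
    and rec: "reconfigurable (alliance_property g) Y G k S T"
    by (auto simp: reconf_problem_def)
  have sub: "S \<subseteq> {..<n}" "T \<subseteq> {..<n}"
    using X[THEN alliance_property_PA] G(2) by (simp_all add: powerful_alliance_def)
  \<comment> \<open>For addition/removal the problem bounds the sizes only along the sequence, which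
    contains both \<open>S\<close> and \<open>T\<close>.\<close>
  have "card S \<le> k \<and> card T \<le> k"
  proof (cases "Y = TAR")
    case True
    from rec obtain As where "As \<noteq> []" "hd As = S" "last As = T"
      "\<forall>A\<in>set As. Y = TAR \<longrightarrow> card A \<le> k"
      unfolding reconfigurable_def by blast
    then show ?thesis
      using True hd_in_set[of As] last_in_set[of As] by auto
  qed (use size in simp)
  then have "check g Y k n (matrix G n) (vec n S) (vec n T)"
    using check_iff[OF square_matrix, of G n "vec n S" "vec n T" g Y k] pair_graph_graph_of[OF
        square_matrix, of G n]
      G X size rec sub
    by (simp add: graph_of_matrix supp_vec)
  then show "accepts g Y w k"
    using decode_encode[OF square_matrix, of "vec n S" n "vec n T" G]
    unfolding w instance_word_eq_encode[OF G(2)] by (simp add: accepts_def)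
qed

section \<open>The parameter function\<close>

definition exp2 :: "nat \<Rightarrow> nat" where
  "exp2 n = 2 ^ n"

lemma exp2_mono: "m \<le> n \<Longrightarrow> exp2 m \<le> exp2 n"
  by (simp add: exp2_def)

text \<open>The region has cubic size, hence exponentially many candidate subsets, and a search of that
  depth and branching takes \<open>m\<^sup>m\<close> steps for \<open>m\<close> candidates; the remaining exponentials
  absorb constants and the polynomial.\<close>

definition tower :: "nat \<Rightarrow> nat" where
  "tower k = exp2 (exp2 (exp2 (exp2 (k + 3))))"

text \<open>Function 2 doubles a unary number, and function 1 computes \<open>exp2\<close> by
  repeated doubling.\<close>

definition tower_prog :: prog where
  "tower_prog =
    [ECall 1 [ECall 1 [ECall 1 [ECall 1 [ENode ELeaf (ENode ELeaf (ENode ELeaf (EVar 0)))]]]],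
     EIf (EVar 0) (ECall 2 [ECall 1 [ESnd (EVar 0)]]) ETrue,
     EIf (EVar 0) (ENode ELeaf (ENode ELeaf (ECall 2 [ESnd (EVar 0)]))) ELeaf]"

lemma computes_double: "\<exists>t. fcall tower_prog 2 [nat_val n] = Some (nat_val (2 * n), t)"
proof -
  have unfold: "fcall tower_prog 2 vs =
      ev tower_prog vs (EIf (EVar 0) (ENode ELeaf (ENode ELeaf (ECall 2 [ESnd
          (EVar 0)]))) ELeaf)" for vs
    by (simp add: fcall_def) (simp add: tower_prog_def)
  show ?thesis
  proof (induction n)
    case 0
    show ?case
      by (subst unfold) (simp add: ev_simps)
  next
    case (Suc n)
    then show ?case
      by (subst unfold) (auto simp: ev_simps)
  qed
qed

lemma computes_exp2: "\<exists>t. fcall tower_prog 1 [nat_val n] = Some (nat_val (exp2 n), t)"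
proof -
  have unfold: "fcall tower_prog 1 vs =
      ev tower_prog vs (EIf (EVar 0) (ECall 2 [ECall 1 [ESnd (EVar 0)]]) ETrue)" for vs
    by (simp add: fcall_def) (simp add: tower_prog_def)
  show ?thesis
  proof (induction n)
    case 0
    show ?case
      by (subst unfold) (simp add: ev_simps exp2_def)
  next
    case (Suc n)
    then obtain t where "fcall tower_prog 1 [nat_val n] = Some (nat_val (exp2 n), t)" ..
    moreover obtain t' where "fcall tower_prog 2 [nat_val (exp2 n)] = Some (nat_val (exp2
        (Suc n)), t')"
      using computes_double[of "exp2 n"] by (auto simp: exp2_def)
    ultimately show ?case
      by (subst unfold) (simp add: ev_simps)
  qed
qed

lemma computable_tower: "computable_nat_fun tower"
proof -
  have "\<exists>t. runs tower_prog [nat_val n] (nat_val (tower n)) t" for n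
  proof -
    obtain t1 where t1: "fcall tower_prog 1 [nat_val (n + 3)] = Some (nat_val (exp2 (n + 3)), t1)"
      using computes_exp2 by blast
    obtain t2 where t2: "fcall tower_prog 1 [nat_val (exp2 (n + 3))] = Some (nat_val (exp2 (exp2
        (n + 3))), t2)"
      using computes_exp2 by blast
    obtain t3 where t3: "fcall tower_prog 1 [nat_val (exp2 (exp2 (n + 3)))] =
        Some (nat_val (exp2 (exp2 (exp2 (n + 3)))), t3)"
      using computes_exp2 by blast
    obtain t4 where t4: "fcall tower_prog 1 [nat_val (exp2 (exp2 (exp2 (n + 3))))] = Some
        (nat_val (tower n), t4)"
      using computes_exp2 unfolding tower_def by blast
    have "Node Leaf (Node Leaf (Node Leaf (nat_val n))) = nat_val (n + 3)"
      by (simp add: eval_nat_numeral)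
    then have "\<exists>t. ev tower_prog [nat_val n]
        (ECall 1 [ECall 1 [ECall 1 [ECall 1 [ENode ELeaf (ENode ELeaf (ENode ELeaf (EVar 0)))]]]]) =
        Some (nat_val (tower n), t)"
      using t1 t2 t3 t4 by (simp add: ev_simps)
    then show ?thesis
      by (simp add: runs_def ev_iff) (simp add: tower_prog_def)
  qed
  then show ?thesis
    unfolding computable_nat_fun_def by blast
qed

text \<open>With \<open>g\<close> the exponent of \<open>m\<close>, the search takes about
  \<open>2 ^ (g * m)\<close> steps, so \<open>h\<close> is at most doubly exponential in
  \<open>g\<close>. A third exponential dominates the cubic polynomial \<open>g\<close>, and the
  fourth turns the linear term \<open>3 * k + 5\<close> into \<open>exp2 (k + 3)\<close>.\<close>

lemma le_tower:
  fixes k :: nat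
  defines "m \<equiv> 2 ^ (2 * k + k * (2 * k + 2) * (2 * k + 2))"
  shows "5000 + 100 * (k + 1) + 5000 * (2 * (m + 2)) ^ (m + 1) \<le> tower k"
proof -
  define g where "g = 2 * k + k * (2 * k + 2) * (2 * k + 2)"
  define h where "h = (2 * (m + 2)) ^ (m + 1)"
  have m: "m = 2 ^ g"
    by (simp add: m_def g_def)
  have Suc_le: "n + 1 \<le> 2 ^ n" for n :: nat
    by (induction n) auto
  have "2 * (m + 2) \<le> 2 ^ (g + 3)"
    using Suc_le[of g] by (simp add: m power_add)
  then have "h \<le> (2 ^ (g + 3)) ^ (m + 1)"
    unfolding h_def by (rule power_mono) simp
  also have "\<dots> = exp2 ((g + 3) * (m + 1))"
    unfolding exp2_def by (simp only: power_mult)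
  finally have h: "h \<le> exp2 ((g + 3) * (m + 1))" .
  have "k + 1 \<le> 2 * (m + 2)"
    using Suc_le[of g] by (simp add: m g_def)
  also have "\<dots> \<le> h"
    unfolding h_def by (rule self_le_power) simp_all
  finally have "k + 1 \<le> h" .
  \<comment> \<open>Each summand is a multiple of \<open>h\<close>, in total at most
    \<open>10100 * h\<close>, and \<open>2 ^ 14\<close> is 16384.\<close>
  then have "5000 + 100 * (k + 1) + 5000 * h \<le> 2 ^ 14 * h"
    by simp
  also have "\<dots> \<le> 2 ^ 14 * exp2 ((g + 3) * (m + 1))"
    using h by (rule mult_le_mono2)
  also have "\<dots> = exp2 (14 + (g + 3) * (m + 1))"
    unfolding exp2_def by (simp only: power_add)
  also have "\<dots> \<le> exp2 (exp2 (2 * g + 5))"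
  proof (rule exp2_mono)
    have "(g + 3) * (m + 1) \<le> 2 ^ (g + 2) * 2 ^ (g + 1)"
      using Suc_le[of g] by (intro mult_le_mono) (simp_all add: m power_add)
    also have "\<dots> = 8 * (2 ^ g * 2 ^ g)"
      by (simp add: power_add)
    also have "\<dots> = 2 ^ (2 * g) * 8"
      by (simp flip: power_add mult_2)
    finally have "(g + 3) * (m + 1) \<le> 2 ^ (2 * g) * 8" .
    moreover have "(1 :: nat) \<le> 2 ^ (2 * g)"
      by simp
    moreover have "exp2 (2 * g + 5) = 2 ^ (2 * g) * 32"
      by (simp add: exp2_def power_add)
    ultimately show "14 + (g + 3) * (m + 1) \<le> exp2 (2 * g + 5)"
      by linarith
  qed
  \<comment> \<open>With \<open>a = 2 ^ k\<close> the cubic term is at most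
    \<open>4 * a ^ 3\<close>; the total of at most \<open>17 * a ^ 3\<close> is rounded up to
    \<open>2 ^ 5 * a ^ 3\<close>, which explains \<open>3 * k + 5\<close>.\<close>
  also have "\<dots> \<le> exp2 (exp2 (exp2 (3 * k + 5)))"
  proof (intro exp2_mono)
    define a :: nat where "a = 2 ^ k"
    have a: "k + 1 \<le> a" "1 \<le> a"
      using Suc_le[of k] by (simp_all add: a_def)
    have "k * (2 * k + 2) * (2 * k + 2) \<le> a * (2 * a) * (2 * a)"
      using a by (intro mult_le_mono) auto
    then have "2 * g + 5 \<le> 4 * a + 8 * (a * a * a) + 5"
      using a by (simp add: g_def)
    also have "\<dots> \<le> 32 * (a * a * a)"
    proof -
      have "a * 1 * 1 \<le> a * a * a" "1 * 1 * 1 \<le> a * a * a"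
        using a by (intro mult_le_mono; simp)+
      then show ?thesis
        unfolding mult_1_right by linarith
    qed
    also have "\<dots> = exp2 (3 * k + 5)"
    proof -
      have "(2 :: nat) ^ (3 * k) = a ^ 3"
        unfolding a_def by (metis mult.commute power_mult)
      then show ?thesis
        by (simp add: exp2_def power_add power3_eq_cube)
    qed
    finally show "2 * g + 5 \<le> exp2 (3 * k + 5)" .
  qed
  also have "\<dots> \<le> tower k"
    unfolding tower_def
  proof (intro exp2_mono)
    show "3 * k + 5 \<le> exp2 (k + 3)"
      using Suc_le[of k] by (simp add: exp2_def power_add)
  qed
  finally show ?thesis
    by (simp add: h_def)
qed

text \<open>All parts outside the search cost at most quadratic time plus a term linear in
  \<open>k\<close>. The search multiplies a quadratic factor by a function of \<open>k\<close>, so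
  the exponent 2 is enough.\<close>

lemma computes_alg:
  "computes (alg g Y) main_fn [word_val w, nat_val k] (bool_val (accepts g Y w k)) (tower k *
      (length w + 1) ^ 2)"
proof -
  define W where "W = length w + 1"
  define m :: nat where "m = 2 ^ (2 * k + k * (2 * k + 2) * (2 * k + 2))"
  define h where "h = (2 * (m + 2)) ^ (m + 1)"
  define n M S T where "n = size_of w" "M = matrix_of w" "S = source_of w" "T = target_of w"
  note defs = this
  have "computes (alg g Y) main_fn [word_val w, nat_val k] (bool_val (accepts g Y w k))
    (5000 * (length w + 1) ^ 2 + 100 * (k + 1) + 5000 * W * W * h)"
  proof (rule computes_main, fold defs)
    assume T: "length T = n" and sym: "symm M" and ok: "ok g M k S" "ok g M k T"
    have M: "square n M" and S: "length S = n"
      using square_matrix_of[of w] T by (simp_all add: defs)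
    interpret adjacency_matrix n M
      using M sym by unfold_locales
    let ?m = "length (subvectors (region M k S T))"
    have "?m \<le> m"
      using length_subvectors_region_le[OF S ok(1) T ok(2)] by (simp only: m_def)
    then have "(2 * (?m + 2)) ^ (?m + 1) \<le> (2 * (m + 2)) ^ (?m + 1)"
      by (intro power_mono) auto
    also have "\<dots> \<le> h"
      unfolding h_def using \<open>?m \<le> m\<close> by (intro power_increasing) auto
    finally have "5000 * (n + 1) * (n + 1) * (2 * (?m + 2)) ^ (?m + 1) \<le> 5000 * W * W * h"
      using size_of_le[of w] by (intro mult_le_mono) (auto simp: W_def defs)
    with computes_solve[OF M S T]
    show "computes (alg g Y) solve_fn [nat_val k, mat_val M, word_val S, word_val T]
        (bool_val (solve g Y k M S T)) (5000 * W * W * h)"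
      by (rule computes_mono)
  qed
  moreover have "5000 * (length w + 1) ^ 2 + 100 * (k + 1) + 5000 * W * W * h \<le> tower k *
      (length w + 1) ^ 2"
  proof -
    have "5000 * W ^ 2 + 100 * (k + 1) * 1 + 5000 * W * W * h \<le> 5000 * W ^ 2 + 100 *
        (k + 1) * W ^ 2 + 5000 * W * W * h"
      by (intro add_mono mult_le_mono order_refl one_le_power) (simp add: W_def)
    also have "\<dots> = (5000 + 100 * (k + 1) + 5000 * h) * W ^ 2"
      by (simp add: algebra_simps power2_eq_square)
    also have "\<dots> \<le> tower k * W ^ 2"
      using le_tower[of k] unfolding h_def m_def by (rule mult_le_mono1)
    finally show ?thesis
      by (simp add: W_def)
  qed
  ultimately show ?thesis
    by (rule computes_mono)
qed

lemma fpt_alliance_property: "fixed_parameter_tractable (reconf_problem (alliance_property g) Y)"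
proof -
  have "\<exists>v t. runs (alg g Y) [word_val w, nat_val k] v t \<and> t \<le> tower k * (length w + 1) ^ 2 \<and>
      (v \<noteq> Leaf \<longleftrightarrow> (w, k) \<in> reconf_problem (alliance_property g) Y)" for w k
  proof -
    obtain t where "runs (alg g Y) [word_val w, nat_val k] (bool_val (accepts g Y w k)) t"
        "t \<le> tower k * (length w + 1) ^ 2"
      using computes_runs[OF computes_alg] by blast
    then show ?thesis
      unfolding accepts_iff[symmetric] by (intro exI[of _ "bool_val
          (accepts g Y w k)"] exI[of _ t]) simp
  qed
  then show ?thesis
    unfolding fixed_parameter_tractable_def using computable_tower by blast
qed

theorem theorem7:
  fixes Y :: reconf_rule
  shows "fixed_parameter_tractable (reconf_problem powerful_alliance Y) \<and>
         fixed_parameter_tractable (reconf_problem global_powerful_alliance Y)"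
  using fpt_alliance_property[of False Y] fpt_alliance_property[of True Y]
  by (simp add: alliance_property_def)

end
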